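(* For a ring graph $G$ with $n$ nodes, the $k$-leader selection algorithm for coherence in a ring graph (the specific algorithm described in the context) identifies the leader set $S$, with $|S|\le k$, that minimizes $R(S)$, in $O(kn^3)$ operations.
   Context: Setting. The ring graph has $n\ge 3$ nodes $V=\{1,\dots,n\}$, numbered clockwise, with edges joining $i$ and $i+1$ for $1\le i\le n-1$ and joining $n$ and $1$ (both directions are in the edge set $E$); $N(i)$ is the set of neighbors of $i$. Each edge carries a noise parameter $\nu_{ij}=\nu_{ji}>0$. The weighted Laplacian $L\in\mathbb{R}^{n\times n}$ is $L_{ij}=-1/\nu_{ij}$ if $(i,j)\in E$, $L_{ii}=\sum_{j\in N(i)}1/\nu_{ij}$, and $L_{ij}=0$ otherwise. For a (nonempty) leader set $S\subseteq V$, $L_{ff}$ is the submatrix of $L$ obtained by deleting the rows and columns indexed by $S$, and $R(S)=\frac12\mathrm{tr}(L_{ff}^{-1})$ is the total steady-state variance of the noisy leader-follower formation with leader set $S$. The trace of the inverse of a matrix of size $0$ is $0$. The positive integer $k$ is the bound on the number of leaders. The digraphs. For distinct $u,v\in V$, $L_{(u\to v)}$ is the submatrix of $L$ on the rows and columns of the nodes strictly between $u$ and $v$ going clockwise from $u$ to $v$, and $R_{(u\to v)}=\frac12\mathrm{tr}(L_{(u\to v)}^{-1})$. For $i\in V$, the weighted digraph $\overline{G}_i$ has node set $\{s_i,t_i\}\cup(V\setminus\{i\})$, with source $s_i$ and target $t_i$, and edges: $(s_i,v)$ for each $v\in V\setminus\{i\}$ with weight $R_{(i\to v)}$; $(u,v)$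 for all distinct $u,v\in V\setminus\{i\}$ with weight $R_{(u\to v)}$; and $(v,t_i)$ for each $v\in V\setminus\{i\}$ with weight $R_{(v\to i)}$. Modified Bellman-Ford. Given a weighted digraph with edge weights $w(u,v)$, a source $s$, a target $t$ and a number $H$, set $d_0(s)=0$, $d_m(s)=\infty$ for $m=1,\dots,H$, and $d_m(v)=\infty$ for $v\ne s$ and $m=0,\dots,H$. For $m=1,\dots,H$ and each node $v$, set $d_m(v)=\min_u\{d_{m-1}(u)+w(u,v)\}$ over the nodes $u$ having an edge to $v$, and record a minimizing $u$ as the predecessor $\pi_m(v)$. Among the computed paths from $s$ to $t$ with $m$ edges, $m=1,\dots,H$, the one of minimum weight is retrieved by following predecessors, and its node list and its weight are returned. The $k$-leader selection algorithm. Given $G$, its weights and $k$: form $L$; compute the weights $R_{(u\to v)}$ for all ordered pairs of distinct nodes once and store them, each by a linear-time method for the trace of the inverse of a tridiagonal matrix (after cyclically shifting the rows and columns of $L$). For each candidate leader $i=1,\dots,n$, construct $\overline{G}_i$ and run the modified Bellman-Ford algorithm on it from $s_i$ to $t_i$ with $H=k$, obtaining a path with node list $P_i$ and its weight; the corresponding leader set is $S_i=(P_i\setminus\{s_i,t_i\})\cup\{i\}$. Return the set $S=S_i$ whose path weight is smallest over all $i$, and $R(S)$ equal to that weight.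
   Formalization: For k = 1 the digraphs have no edge from s_i to t_i, so no path with at most one edge exists and the claim fails; that S minimizes R(S), with R(S) equal to the path weight, is therefore stated for k ≥ 2, while |S| ≤ k and the O(kn^3) bound are stated for all k ≥ 1. *)

theory Defs
  imports
    "Jordan_Normal_Form.DL_Submatrix"
    "Jordan_Normal_Form.Gauss_Jordan_Elimination"
    "HOL-Library.Extended_Real"
    "HOL-Library.Monad_Syntax"
begin

section \<open>Leader selection in the ring\<close>

text \<open>
  The nodes are \<open>0, \<dots>, n - 1\<close>, numbered clockwise, so that the clockwise successor of \<open>i\<close> is
  \<open>(i + 1) mod n\<close>.
\<close>

definition ring_edges :: "nat \<Rightarrow> (nat \<times> nat) set" where
  "ring_edges n = {(i, j). i < n \<and> j < n \<and> (j = (i + 1) mod n \<or> i = (j + 1) mod n)}"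

definition ring_nbrs :: "nat \<Rightarrow> nat \<Rightarrow> nat set" where
  "ring_nbrs n i = {j. (i, j) \<in> ring_edges n}"

definition ring_noise :: "nat \<Rightarrow> (nat \<Rightarrow> nat \<Rightarrow> real) \<Rightarrow> bool" where
  "ring_noise n \<nu> \<longleftrightarrow> (\<forall>(i, j) \<in> ring_edges n. \<nu> i j = \<nu> j i \<and> 0 < \<nu> i j)"

definition laplacian :: "nat \<Rightarrow> (nat \<Rightarrow> nat \<Rightarrow> real) \<Rightarrow> real mat" where
  "laplacian n \<nu> = mat n n (\<lambda>(i, j).
     if i = j then \<Sum>k \<in> ring_nbrs n i. 1 / \<nu> i k
     else if (i, j) \<in> ring_edges n then - (1 / \<nu> i j)
     else 0)"

definition mat_trace :: "real mat \<Rightarrow> real" where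
  "mat_trace A = (\<Sum>i < dim_row A. A $$ (i, i))"

text \<open>For the matrix of size 0 this is 0, as \<^const>\<open>mat_inverse\<close> returns that matrix itself.\<close>

definition half_trace_inverse :: "real mat \<Rightarrow> real" where
  "half_trace_inverse A = 1 / 2 * mat_trace (the (mat_inverse A))"

definition total_variance :: "nat \<Rightarrow> (nat \<Rightarrow> nat \<Rightarrow> real) \<Rightarrow> nat set \<Rightarrow> real" where
  "total_variance n \<nu> S =
     half_trace_inverse (submatrix (laplacian n \<nu>) ({..<n} - S) ({..<n} - S))"

definition feasible_leaders :: "nat \<Rightarrow> nat \<Rightarrow> nat set \<Rightarrow> bool" where
  "feasible_leaders n k S \<longleftrightarrow> S \<subseteq> {..<n} \<and> S \<noteq> {} \<and> card S \<le> k"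

text \<open>
  The edge weights of the digraphs below. The program \<open>arc_weight\<close> computes them without forming
  an inverse.
\<close>

definition arc_interior :: "nat \<Rightarrow> nat \<Rightarrow> nat \<Rightarrow> nat set" where
  "arc_interior n u v = {(u + j) mod n | j. 0 < j \<and> j < (v + n - u) mod n}"

definition arc_variance :: "nat \<Rightarrow> (nat \<Rightarrow> nat \<Rightarrow> real) \<Rightarrow> nat \<Rightarrow> nat \<Rightarrow> real" where
  "arc_variance n \<nu> u v =
     half_trace_inverse (submatrix (laplacian n \<nu>) (arc_interior n u v) (arc_interior n u v))"


section \<open>Counting operations\<close>

text \<open>
  A program is run on a unit-cost machine with real arithmetic. Every primitive step (an arithmetic
  operation, a comparison, reading or writing one array cell, extending a linked list, advancing a
  loop counter) is wrapped in \<open>op\<close> or \<open>tick\<close> and counted once; binding variables, branching on an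
  already computed truth value and returning a value are free. Arrays are modelled by lists with
  \<open>xs ! i\<close> as the read of a cell; they are only ever filled from left to right, so that
  \<open>xs @ [x]\<close> is the write of the next cell.
\<close>

datatype 'a counted = Counted (result: 'a) (ops: nat)

definition ret :: "'a \<Rightarrow> 'a counted" where
  "ret x = Counted x 0"

definition op :: "'a \<Rightarrow> 'a counted" where
  "op x = Counted x 1"

definition tick :: "unit counted" where
  "tick = op ()"

definition bind_counted :: "'a counted \<Rightarrow> ('a \<Rightarrow> 'b counted) \<Rightarrow> 'b counted" where
  "bind_counted m f = Counted (result (f (result m))) (ops m + ops (f (result m)))"

adhoc_overloading Monad_Syntax.bind \<rightleftharpoons> bind_counted

definition branch :: "bool counted \<Rightarrow> 'a counted \<Rightarrow> 'a counted \<Rightarrow> 'a counted" where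
  "branch c x y = do { b \<leftarrow> c; if b then x else y }"

text \<open>\<open>loop m f s\<close> runs \<open>s := f j s\<close> for \<open>j = 0, \<dots>, m - 1\<close>.\<close>

primrec loop :: "nat \<Rightarrow> (nat \<Rightarrow> 's \<Rightarrow> 's counted) \<Rightarrow> 's \<Rightarrow> 's counted" where
  "loop 0 f s = ret s"
| "loop (Suc m) f s = do { s' \<leftarrow> loop m f s; tick; f m s' }"

definition array_of :: "nat \<Rightarrow> (nat \<Rightarrow> 'a counted) \<Rightarrow> 'a list counted" where
  "array_of m f = loop m (\<lambda>j xs. do { x \<leftarrow> f j; op (xs @ [x]) }) []"

definition read2 :: "'a list list \<Rightarrow> nat \<Rightarrow> nat \<Rightarrow> 'a counted" where
  "read2 A i j = do { r \<leftarrow> op (A ! i); op (r ! j) }"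


section \<open>The weights\<close>

definition laplacian_array :: "nat \<Rightarrow> (nat \<Rightarrow> nat \<Rightarrow> real) \<Rightarrow> real list list counted" where
  "laplacian_array n \<nu> =
     array_of n (\<lambda>i. do {
       i1 \<leftarrow> op (i + 1);
       next \<leftarrow> op (i1 mod n);
       i2 \<leftarrow> op (i + n);
       i3 \<leftarrow> op (i2 - 1);
       prev \<leftarrow> op (i3 mod n);
       x \<leftarrow> op (\<nu> i next);
       y \<leftarrow> op (\<nu> i prev);
       a \<leftarrow> op (1 / x);
       b \<leftarrow> op (1 / y);
       a' \<leftarrow> op (- a);
       b' \<leftarrow> op (- b);
       d \<leftarrow> op (a + b);
       array_of n (\<lambda>j.
         branch (op (j = i)) (ret d)
         (branch (op (j = next)) (ret a')
         (branch (op (j = prev)) (ret b')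
         (ret 0))))
     })"

text \<open>
  Let \<open>T\<close> be symmetric tridiagonal of size \<open>m\<close> with diagonal \<open>a\<close> and off-diagonal
  \<open>b ! j = T\<^sub>j\<^sub>,\<^sub>j\<^sub>+\<^sub>1\<close>. Its pivots from the top are \<open>d\<^sub>0 = a\<^sub>0\<close>,
  \<open>d\<^sub>j = a\<^sub>j - b\<^sub>j\<^sub>-\<^sub>1\<^sup>2 / d\<^sub>j\<^sub>-\<^sub>1\<close>. With \<open>e\<close> the pivots of
  the matrix with the order of rows and columns reversed, the diagonal of the inverse is
  \<open>1 / (d\<^sub>j + e\<^sub>m\<^sub>-\<^sub>1\<^sub>-\<^sub>j - a\<^sub>j)\<close>.
\<close>

definition pivots :: "nat \<Rightarrow> real list \<Rightarrow> real list \<Rightarrow> real list counted" where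
  "pivots m a b = loop m (\<lambda>j ds. do {
     x \<leftarrow> op (a ! j);
     branch (op (j = 0))
       (op (ds @ [x]))
       (do {
         j' \<leftarrow> op (j - 1);
         y \<leftarrow> op (b ! j');
         d \<leftarrow> op (ds ! j');
         z \<leftarrow> op (y * y);
         q \<leftarrow> op (z / d);
         r \<leftarrow> op (x - q);
         op (ds @ [r])
       })
   }) []"

definition reverse_array :: "nat \<Rightarrow> 'a list \<Rightarrow> 'a list counted" where
  "reverse_array m xs = array_of m (\<lambda>j. do {
     l \<leftarrow> op (m - 1);
     i \<leftarrow> op (l - j);
     op (xs ! i)
   })"

definition tridiagonal_trace_inverse :: "nat \<Rightarrow> real list \<Rightarrow> real list \<Rightarrow> real counted" where
  "tridiagonal_trace_inverse m a b = do {
     m' \<leftarrow> op (m - 1);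
     ds \<leftarrow> pivots m a b;
     ra \<leftarrow> reverse_array m a;
     rb \<leftarrow> reverse_array m' b;
     res \<leftarrow> pivots m ra rb;
     es \<leftarrow> reverse_array m res;
     loop m (\<lambda>j acc. do {
       d \<leftarrow> op (ds ! j);
       e \<leftarrow> op (es ! j);
       x \<leftarrow> op (a ! j);
       s \<leftarrow> op (d + e);
       t \<leftarrow> op (s - x);
       r \<leftarrow> op (1 / t);
       op (acc + r)
     }) 0
   }"

text \<open>
  Computes \<^term>\<open>arc_variance n \<nu> u v\<close> for distinct \<open>u, v < n\<close>. Shifting the rows and columns of \<open>L\<close> cyclically by \<open>u + 1\<close> turns the
  submatrix for the interior of the arc into the leading principal submatrix, which is tridiagonal;
  only its diagonal and off-diagonal are read.
\<close>

definition arc_weight :: "nat \<Rightarrow> real list list \<Rightarrow> nat \<Rightarrow> nat \<Rightarrow> real counted" where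
  "arc_weight n L u v = do {
     s \<leftarrow> op (u + 1);
     x \<leftarrow> op (v + n);
     y \<leftarrow> op (x - u);
     z \<leftarrow> op (y mod n);
     m \<leftarrow> op (z - 1);
     m' \<leftarrow> op (m - 1);
     a \<leftarrow> array_of m (\<lambda>j. do {
       p \<leftarrow> op (s + j);
       p' \<leftarrow> op (p mod n);
       read2 L p' p'
     });
     b \<leftarrow> array_of m' (\<lambda>j. do {
       p \<leftarrow> op (s + j);
       q \<leftarrow> op (p + 1);
       p' \<leftarrow> op (p mod n);
       q' \<leftarrow> op (q mod n);
       read2 L p' q'
     });
     t \<leftarrow> tridiagonal_trace_inverse m a b;
     op (t / 2)
   }"

text \<open>The diagonal entries of the table are never used.\<close>

definition weight_table :: "nat \<Rightarrow> real list list \<Rightarrow> real list list counted" where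
  "weight_table n L =
     array_of n (\<lambda>u. array_of n (\<lambda>v. branch (op (u = v)) (ret 0) (arc_weight n L u v)))"


section \<open>The digraphs and the modified Bellman-Ford algorithm\<close>

text \<open>
  A weighted digraph on the nodes \<open>0, \<dots>, N - 1\<close> is stored as its matrix of edge weights, with
  \<^const>\<open>None\<close> where there is no edge. The digraph for the candidate leader \<open>i\<close> has \<open>n + 1\<close> nodes:
  a node \<open>v \<noteq> i\<close> of the ring keeps its number, the source has the number \<open>i\<close> and the target the
  number \<open>n\<close>.
\<close>

definition leader_digraph :: "nat \<Rightarrow> real list list \<Rightarrow> nat \<Rightarrow> real option list list counted" where
  "leader_digraph n W i = do {
     N \<leftarrow> op (n + 1);
     array_of N (\<lambda>u. array_of N (\<lambda>v.
       branch (op (u = n)) (ret None)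
       (branch (op (v = i)) (ret None)
       (branch (op (u = v)) (ret None)
       (branch (op (v = n))
          (branch (op (u = i)) (ret None) (do { w \<leftarrow> read2 W u i; ret (Some w) }))
          (do { w \<leftarrow> read2 W u v; ret (Some w) }))))))
   }"

text \<open>
  A row of the table for \<open>m\<close> edges holds at \<open>v\<close> the pair of \<open>d\<^sub>m(v)\<close> and \<open>\<pi>\<^sub>m(v)\<close>; the latter is
  \<^const>\<open>None\<close> if \<open>d\<^sub>m(v) = \<infinity>\<close>. Ties are broken in favour of the smallest number.
\<close>

type_synonym bf_row = "(ereal \<times> nat option) list"

definition relax :: "nat \<Rightarrow> real option list list \<Rightarrow> bf_row \<Rightarrow> nat \<Rightarrow> (ereal \<times> nat option) counted" where
  "relax N G D v = loop N (\<lambda>u (best, p). do {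
     e \<leftarrow> read2 G u v;
     tick;
     case e of
       None \<Rightarrow> ret (best, p)
     | Some w \<Rightarrow> do {
         (d, _) \<leftarrow> op (D ! u);
         c \<leftarrow> op (d + ereal w);
         branch (op (c < best)) (ret (c, Some u)) (ret (best, p))
       }
   }) (\<infinity>, None)"

definition bf_table :: "nat \<Rightarrow> real option list list \<Rightarrow> nat \<Rightarrow> nat \<Rightarrow> bf_row list counted" where
  "bf_table N G s H = do {
     D0 \<leftarrow> array_of N (\<lambda>v. branch (op (v = s)) (ret (0, None)) (ret (\<infinity>, None)));
     loop H (\<lambda>m Ds. do {
       D \<leftarrow> op (Ds ! m);
       D' \<leftarrow> array_of N (\<lambda>v. branch (op (v = s)) (ret (\<infinity>, None)) (relax N G D v));
       op (Ds @ [D'])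
     }) [D0]
   }"

text \<open>The weight of the best path, and its number of edges, which is 0 if there is no path.\<close>

definition bf_best :: "bf_row list \<Rightarrow> nat \<Rightarrow> nat \<Rightarrow> (ereal \<times> nat) counted" where
  "bf_best Ds t H = loop H (\<lambda>j (best, m). do {
     l \<leftarrow> op (j + 1);
     (d, _) \<leftarrow> read2 Ds l t;
     branch (op (d < best)) (ret (d, l)) (ret (best, m))
   }) (\<infinity>, 0)"

definition bf_path :: "bf_row list \<Rightarrow> nat \<Rightarrow> nat \<Rightarrow> nat list counted" where
  "bf_path Ds t m = do {
     (_, path) \<leftarrow> loop m (\<lambda>j (v, path). do {
       l \<leftarrow> op (m - j);
       (_, p) \<leftarrow> read2 Ds l v;
       path' \<leftarrow> op (the p # path);
       ret (the p, path')
     }) (t, [t]);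
     ret path
   }"

definition bellman_ford ::
    "nat \<Rightarrow> real option list list \<Rightarrow> nat \<Rightarrow> nat \<Rightarrow> nat \<Rightarrow> (nat list \<times> ereal) counted" where
  "bellman_ford N G s t H = do {
     Ds \<leftarrow> bf_table N G s H;
     (w, m) \<leftarrow> bf_best Ds t H;
     branch (op (m = 0))
       (ret ([], \<infinity>))
       (do { path \<leftarrow> bf_path Ds t m; ret (path, w) })
   }"


section \<open>The leader selection algorithm\<close>

text \<open>Sets of nodes are represented by lists, possibly with repetitions.\<close>

primrec remove_ends :: "nat \<Rightarrow> nat \<Rightarrow> nat list \<Rightarrow> nat list counted" where
  "remove_ends s t [] = ret []"
| "remove_ends s t (p # ps) = do {
     tick;
     qs \<leftarrow> remove_ends s t ps;
     branch (op (p = s)) (ret qs)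
     (branch (op (p = t)) (ret qs)
     (op (p # qs)))
   }"

definition candidate :: "nat \<Rightarrow> real list list \<Rightarrow> nat \<Rightarrow> nat \<Rightarrow> (nat list \<times> ereal) counted" where
  "candidate n W k i = do {
     G \<leftarrow> leader_digraph n W i;
     N \<leftarrow> op (n + 1);
     (P, w) \<leftarrow> bellman_ford N G i n k;
     S \<leftarrow> remove_ends i n P;
     S' \<leftarrow> op (i # S);
     ret (S', w)
   }"

definition leader_selection ::
    "nat \<Rightarrow> (nat \<Rightarrow> nat \<Rightarrow> real) \<Rightarrow> nat \<Rightarrow> (nat list \<times> ereal) counted" where
  "leader_selection n \<nu> k = do {
     L \<leftarrow> laplacian_array n \<nu>;
     W \<leftarrow> weight_table n L;
     cs \<leftarrow> array_of n (candidate n W k);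
     best \<leftarrow> loop n (\<lambda>i b. do {
       (_, w) \<leftarrow> op (cs ! i);
       (_, w') \<leftarrow> op (cs ! b);
       branch (op (w < w')) (ret i) (ret b)
     }) 0;
     op (cs ! best)
   }"

definition selected_leaders :: "nat \<Rightarrow> (nat \<Rightarrow> nat \<Rightarrow> real) \<Rightarrow> nat \<Rightarrow> nat set" where
  "selected_leaders n \<nu> k = set (fst (result (leader_selection n \<nu> k)))"

definition selected_weight :: "nat \<Rightarrow> (nat \<Rightarrow> nat \<Rightarrow> real) \<Rightarrow> nat \<Rightarrow> ereal" where
  "selected_weight n \<nu> k = snd (result (leader_selection n \<nu> k))"

end

theory Submission
  imports Defs "Jordan_Normal_Form.Determinant"
begin

text \<open>
  The ring is an electrical network: an edge with noise \<open>\<nu>\<close> is a resistor of resistance \<open>\<nu>\<close>, and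
  choosing leaders means grounding nodes. The inverse of the grounded Laplacian is then the Green's
  function of the network, and its diagonal entry at a follower \<open>x\<close> is the effective resistance
  between \<open>x\<close> and the ground. On a ring only the nearest leader on each side matters: with the
  resistances \<open>a\<close> and \<open>b\<close> of the two arcs that lead there, the entry is \<open>a b / (a + b)\<close>
  (\<open>total_variance_eq\<close>). So the total variance splits into contributions of the arcs between
  consecutive leaders, and it can only decrease when leaders are added
  (\<open>total_variance_antimono\<close>).

  A leader set that contains \<open>i\<close> corresponds to the closed walk that starts at \<open>i\<close> and visits the
  leaders once in clockwise order; the walk costs at most the total variance of the set
  (\<open>clockwise_tour\<close>). The digraph of the algorithm admits many other walks, which may jump
  back and forth and wind around the ring several times. None of them can be too cheap: a closed walk
  has to cross every node that it does not visit, and the arc of the crossing step reaches at least as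
  far as the nearest visited nodes. Hence every closed walk costs at least the total variance of
  the set of its nodes (\<open>total_variance_le_closed_walk\<close>). With both bounds, a cheapest closed
  walk with at most \<open>k\<close> steps gives an optimal set, and its weight is the variance of that set.
  Source and target are not adjacent, so the walks yield sets of at least two leaders; for \<open>k \<ge> 2\<close>
  singletons are covered by monotonicity, whereas for \<open>k = 1\<close> no walk is found and the set is
  merely feasible.

  Two facts about the program remain. The linear-time elimination computes the arc
  weights (\<open>result_arc_weight\<close>), because the pivots of a grounded chain are conductances in
  closed form; and the table of the Bellman-Ford method contains cheapest walks, which the
  predecessors reconstruct (\<open>bellman_ford_le\<close>, \<open>bellman_ford_walk\<close>). The operations are counted by
  adding up bounds for the nested loops: computing \<open>n\<^sup>2\<close> weights takes \<open>O(n)\<close> operations each,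
  and each of the \<open>n\<close> candidates fills \<open>k\<close> rows of \<open>O(n)\<close> cells at a price of \<open>O(n)\<close> per cell.
\<close>

section \<open>Results of counted programs\<close>

lemma result_ret [simp]: "result (ret x) = x" and ops_ret [simp]: "ops (ret x) = 0"
  by (simp_all add: ret_def)

lemma result_op [simp]: "result (op x) = x" and ops_op [simp]: "ops (op x) = 1"
  by (simp_all add: op_def)

lemma ops_tick [simp]: "ops tick = 1"
  by (simp add: tick_def)

lemma result_bind [simp]: "result (bind_counted m f) = result (f (result m))"
  and ops_bind [simp]: "ops (bind_counted m f) = ops m + ops (f (result m))"
  by (simp_all add: bind_counted_def)

lemma result_branch [simp]: "result (branch c x y) = (if result c then result x else result y)"
  and ops_branch [simp]: "ops (branch c x y) = ops c + (if result c then ops x else ops y)"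
  by (simp_all add: branch_def)

lemma result_loop_Suc [simp]: "result (loop (Suc m) f s) = result (f m (result (loop m f s)))"
  by simp

lemma result_array_of [simp]: "result (array_of m f) = map (\<lambda>j. result (f j)) [0..<m]"
proof -
  have "result (loop m (\<lambda>j xs. bind_counted (f j) (\<lambda>x. op (xs @ [x]))) []) = map (\<lambda>j. result (f j)) [0..<m]"
    by (induction m) simp_all
  then show ?thesis by (simp add: array_of_def)
qed

lemma result_read2 [simp]: "result (read2 A i j) = A ! i ! j"
  and ops_read2 [simp]: "ops (read2 A i j) = 2"
  by (simp_all add: read2_def)

lemma result_reverse_array [simp]:
  "result (reverse_array m xs) = map (\<lambda>j. xs ! (m - 1 - j)) [0..<m]"
  by (simp add: reverse_array_def)

section \<open>Resistances along the ring\<close>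

definition offset :: "nat \<Rightarrow> nat \<Rightarrow> nat \<Rightarrow> nat" where
  "offset n u v = (v + n - u) mod n"

lemma offset_eq: "u < n \<Longrightarrow> v < n \<Longrightarrow> offset n u v = (if u \<le> v then v - u else v + n - u)"
  by (auto simp: offset_def mod_if)

lemma offset_less: "u < n \<Longrightarrow> v < n \<Longrightarrow> offset n u v < n"
  by (simp add: offset_def)

lemma add_offset: "u < n \<Longrightarrow> v < n \<Longrightarrow> (u + offset n u v) mod n = v"
  by (auto simp: offset_eq mod_if)

lemma offset_add: "u < n \<Longrightarrow> c < n \<Longrightarrow> offset n u ((u + c) mod n) = c"
  by (auto simp: offset_def mod_if)

lemma offset_same [simp]: "u < n \<Longrightarrow> offset n u u = 0"
  by (simp add: offset_def)

lemma offset_eq_0_iff: "u < n \<Longrightarrow> v < n \<Longrightarrow> offset n u v = 0 \<longleftrightarrow> u = v"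
  by (auto simp: offset_eq)

lemma offset_commute: "u < n \<Longrightarrow> v < n \<Longrightarrow> u \<noteq> v \<Longrightarrow> offset n u v + offset n v u = n"
  by (auto simp: offset_eq)

lemma offset_trans:
  "u < n \<Longrightarrow> v < n \<Longrightarrow> w < n \<Longrightarrow> offset n u v \<le> offset n u w \<Longrightarrow>
    offset n u v + offset n v w = offset n u w"
  by (auto simp: offset_eq split: if_splits)

text \<open>
  Change of the reference node from \<open>i\<close> to \<open>u\<close>; the second case passes \<open>i\<close>.
\<close>

lemma offset_diff:
  assumes "i < n" "u < n" "x < n"
  shows "offset n u x = (if offset n i u \<le> offset n i x then offset n i x - offset n i u
    else offset n i x + n - offset n i u)"
proof (cases "offset n i u \<le> offset n i x")
  case True
  then show ?thesis using offset_trans[OF assms] by simp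
next
  case False
  then have "x \<noteq> u" by auto
  then show ?thesis
    using False offset_trans[of i n x u] offset_commute[of u n x] assms by simp
qed

lemma arc_interior_iff:
  assumes "u < n" "v < n"
  shows "x \<in> arc_interior n u v \<longleftrightarrow> x < n \<and> 0 < offset n u x \<and> offset n u x < offset n u v"
proof
  assume "x \<in> arc_interior n u v"
  then obtain j where j: "x = (u + j) mod n" "0 < j" "j < offset n u v"
    by (auto simp: arc_interior_def offset_def)
  with offset_less[OF assms] have "j < n" by simp
  with j assms show "x < n \<and> 0 < offset n u x \<and> offset n u x < offset n u v"
    by (simp add: offset_add)
next
  assume "x < n \<and> 0 < offset n u x \<and> offset n u x < offset n u v"
  then show "x \<in> arc_interior n u v"
    using assms add_offset[of u n x]
    by (auto simp: arc_interior_def simp flip: offset_def intro!: exI[of _ "offset n u x"])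
qed

definition parallel :: "real \<Rightarrow> real \<Rightarrow> real" where
  "parallel a b = a * b / (a + b)"

lemma parallel_nonneg: "0 \<le> a \<Longrightarrow> 0 \<le> b \<Longrightarrow> 0 \<le> parallel a b"
  by (simp add: parallel_def)

lemma parallel_mono:
  assumes "0 < a" "a \<le> a'" "0 < b" "b \<le> b'"
  shows "parallel a b \<le> parallel a' b'"
proof -
  have "a * b * (a' + b') \<le> a' * b' * (a + b)"
  proof -
    have "(a * a') * b \<le> (a * a') * b'" "(b * b') * a \<le> (b * b') * a'"
      using assms by (auto intro!: mult_left_mono)
    then show ?thesis by (simp add: algebra_simps)
  qed
  then show ?thesis
    using assms by (simp add: parallel_def divide_simps)
qed

locale ring_network =
  fixes n :: nat and \<nu> :: "nat \<Rightarrow> nat \<Rightarrow> real"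
  assumes three_le: "3 \<le> n" and noise: "ring_noise n \<nu>"
begin

definition res :: "nat \<Rightarrow> real" where
  "res i = \<nu> i ((i + 1) mod n)"

lemma n_pos: "0 < n"
  using three_le by simp

lemma res_pos: "i < n \<Longrightarrow> 0 < res i"
  using noise three_le by (auto simp: ring_noise_def ring_edges_def res_def)

lemma noise_pred: 
  assumes "i < n"
  shows "\<nu> i ((i + n - 1) mod n) = res ((i + n - 1) mod n)"
proof -
  let ?p = "(i + n - 1) mod n"
  have "(?p + 1) mod n = i"
    using assms three_le by (auto simp: mod_if)
  then have "(i, ?p) \<in> ring_edges n"
    using assms three_le by (auto simp: ring_edges_def)
  then have "\<nu> i ?p = \<nu> ?p i"
    using noise by (auto simp: ring_noise_def)
  with \<open>(?p + 1) mod n = i\<close> show ?thesis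
    by (simp add: res_def)
qed

text \<open>
  The resistance of the first \<open>c\<close> edges clockwise from \<open>u\<close>; for \<open>c = n\<close> this is the whole ring.
\<close>

definition clockwise_res :: "nat \<Rightarrow> nat \<Rightarrow> real" where
  "clockwise_res u c = (\<Sum>j<c. res ((u + j) mod n))"

definition arc_res :: "nat \<Rightarrow> nat \<Rightarrow> real" where
  "arc_res u v = clockwise_res u (offset n u v)"

lemma clockwise_res_0 [simp]: "clockwise_res u 0 = 0"
  by (simp add: clockwise_res_def)

lemma clockwise_res_Suc [simp]: "clockwise_res u (Suc c) = clockwise_res u c + res ((u + c) mod n)"
  by (simp add: clockwise_res_def)

lemma clockwise_res_add: "clockwise_res u (c + d) = clockwise_res u c + clockwise_res ((u + c) mod n) d"
  by (induction d) (simp_all add: mod_add_left_eq add.assoc)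

lemma strict_mono_clockwise_res: "strict_mono (clockwise_res u)"
  using n_pos by (auto simp: strict_mono_Suc_iff intro: res_pos)

lemma arc_res_pos: "u < n \<Longrightarrow> v < n \<Longrightarrow> u \<noteq> v \<Longrightarrow> 0 < arc_res u v"
  using strict_mono_less[OF strict_mono_clockwise_res, of u 0 "offset n u v"] offset_eq_0_iff[of u n v]
  by (simp add: arc_res_def)

lemma arc_res_nonneg: "0 \<le> arc_res u v"
  using strict_mono_less_eq[OF strict_mono_clockwise_res, of u 0 "offset n u v"]
  by (simp add: arc_res_def)

lemma arc_res_trans:
  assumes "u < n" "v < n" "w < n" "offset n u v \<le> offset n u w"
  shows "arc_res u w = arc_res u v + arc_res v w"
  using clockwise_res_add[of u "offset n u v" "offset n v w"] offset_trans[OF assms] assms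
  by (simp add: arc_res_def add_offset)

lemma arc_res_commute:
  assumes "u < n" "v < n" "u \<noteq> v"
  shows "arc_res u v + arc_res v u = clockwise_res u n"
  using clockwise_res_add[of u "offset n u v" "offset n v u"] offset_commute[OF assms] assms
  by (simp add: arc_res_def add_offset)

text \<open>
  The resistances of the arcs that join \<open>x\<close> to the nearest leader counterclockwise and clockwise. Taking
  minima over all leaders, rather than naming the nearest one, makes the dependence on \<open>S\<close> visibly
  antitone.
\<close>

definition res_behind :: "nat set \<Rightarrow> nat \<Rightarrow> real" where
  "res_behind S x = Min ((\<lambda>u. arc_res u x) ` S)"

definition res_ahead :: "nat set \<Rightarrow> nat \<Rightarrow> real" where
  "res_ahead S x = Min (arc_res x ` S)"

text \<open>
  Current from \<open>x\<close> reaches the ground along the two arcs to the nearest leaders, so this is the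
  effective resistance between \<open>x\<close> and the ground.
\<close>

definition node_variance :: "nat set \<Rightarrow> nat \<Rightarrow> real" where
  "node_variance S x = parallel (res_behind S x) (res_ahead S x)"

end

section \<open>The inverse of the grounded Laplacian\<close>

text \<open>
  A right inverse is the result of the Gauss-Jordan elimination, as inverses of square matrices are
  two-sided and unique.
\<close>

lemma half_trace_inverse_eq:
  assumes M: "M \<in> carrier_mat m m" and G: "G \<in> carrier_mat m m" and MG: "M * G = 1\<^sub>m m"
  shows "half_trace_inverse M = 1 / 2 * mat_trace G"
proof -
  have GM: "G * M = 1\<^sub>m m"
    using mat_mult_left_right_inverse[OF M G MG] .
  have "M \<in> Units (ring_mat TYPE(real) m ())"
    using M G MG GM by (auto simp: Units_def ring_mat_simps)
  then obtain H where H: "mat_inverse M = Some H"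
    using mat_inverse(1)[OF M, of "()"] by (cases "mat_inverse M") auto
  then have MH: "M * H = 1\<^sub>m m" "H \<in> carrier_mat m m"
    using mat_inverse(2)[OF M] by auto
  have "H = (G * M) * H"
    using MH by (simp add: GM)
  also have "\<dots> = G * (M * H)"
    using M G MH by (intro assoc_mult_mat) auto
  also have "\<dots> = G"
    using G by (simp add: MH)
  finally have "H = G" .
  then show ?thesis
    by (simp add: half_trace_inverse_def H)
qed

lemma bij_betw_pick:
  assumes "finite I"
  shows "bij_betw (pick I) {..<card I} I"
proof -
  have "inj_on (pick I) {..<card I}"
    by (intro linorder_inj_onI) (auto dest: pick_mono_le)
  moreover have "pick I ` {..<card I} \<subseteq> I"
    by (auto intro: pick_in_set_le)
  moreover have "card (pick I ` {..<card I}) = card I"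
    using calculation(1) by (simp add: card_image)
  ultimately show ?thesis
    using assms by (simp add: bij_betw_def card_subset_eq)
qed

context ring_network
begin

text \<open>
  The row of \<open>z\<close> adds up the currents that leave \<open>z\<close> over its two edges when \<open>f\<close> is the
  potential. The two neighbours are distinct because there are at least three nodes.
\<close>

lemma laplacian_row:
  assumes z: "z < n"
  shows "(\<Sum>x<n. laplacian n \<nu> $$ (z, x) * f x) =
    (f z - f ((z + 1) mod n)) / res z +
    (f z - f ((z + n - 1) mod n)) / res ((z + n - 1) mod n)"
proof -
  define s where "s = (z + 1) mod n"
  define p where "p = (z + n - 1) mod n"
  have sp: "s < n" "p < n" "s \<noteq> z" "p \<noteq> z" "s \<noteq> p"
    using z three_le by (auto simp: s_def p_def mod_if split: if_splits)
  have zp: "(y + 1) mod n = z \<longleftrightarrow> y = p" if "y < n" for y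
    using z that three_le by (auto simp: p_def mod_if)
  have nbrs: "ring_nbrs n z = {s, p}"
    using z zp sp by (auto simp: ring_nbrs_def ring_edges_def s_def)
  have edges: "(z, x) \<in> ring_edges n \<longleftrightarrow> x = s \<or> x = p" for x
    using nbrs by (auto simp: ring_nbrs_def)
  have \<nu>: "\<nu> z s = res z" "\<nu> z p = res p"
    using noise_pred[OF z] by (simp_all add: res_def s_def p_def)
  have L: "laplacian n \<nu> $$ (z, x) = (if x = z then 1 / res z + 1 / res p else
      if x = s then - (1 / res z) else if x = p then - (1 / res p) else 0)" if "x < n" for x
    using z that sp by (auto simp: laplacian_def nbrs edges \<nu>)
  have "(\<Sum>x<n. laplacian n \<nu> $$ (z, x) * f x) = (\<Sum>x\<in>{z, s, p}. laplacian n \<nu> $$ (z, x) * f x)"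
    using z sp by (intro sum.mono_neutral_right) (auto simp: L)
  also have "\<dots> = (1 / res z + 1 / res p) * f z - 1 / res z * f s - 1 / res p * f p"
    using z sp by (simp add: L)
  also have "\<dots> = (f z - f s) / res z + (f z - f p) / res p"
    by (simp add: algebra_simps diff_divide_distrib)
  finally show ?thesis
    by (simp add: s_def p_def)
qed

text \<open>
  The potential at \<open>x\<close> when a unit current enters at \<open>y\<close> and the leaders are grounded. As a function of
  the clockwise resistance \<open>t\<close> from \<open>y\<close> it falls linearly to 0 at the next leader on either
  side and vanishes beyond. The second maximum measures the ascent from the last leader back to \<open>y\<close>.
  It is written in terms of \<open>t\<close>, not of the arc from \<open>x\<close> to \<open>y\<close>, since the latter would jump at
  \<open>x = y\<close> and count the peak twice.
\<close>

definition green :: "nat set \<Rightarrow> nat \<Rightarrow> nat \<Rightarrow> real" where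
  "green S y x =
    (let A = res_behind S y; B = res_ahead S y; t = arc_res y x
     in A / (A + B) * max 0 (B - t) + B / (A + B) * max 0 (A + t - clockwise_res y n))"

text \<open>
  In the clockwise offset from \<open>y\<close>, the leaders lie between the next one, at \<open>q\<close>, and the last one, at
  \<open>p\<close>. The resistance behind \<open>y\<close> is the complement of the arc from \<open>y\<close> to the last leader.
\<close>

lemma neighbours_exist:
  assumes S: "S \<subseteq> {..<n}" "S \<noteq> {}" and y: "y < n" "y \<notin> S"
  obtains p q where "0 < p" "p < n" "0 < q" "q < n"
    "res_behind S y = clockwise_res y n - clockwise_res y p" "res_ahead S y = clockwise_res y q"
    "\<And>x. x \<in> S \<Longrightarrow> q \<le> offset n y x \<and> offset n y x \<le> p" 
    "(y + p) mod n \<in> S" "(y + q) mod n \<in> S"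
proof -
  have fin: "finite S" using S(1) finite_subset by blast
  have "res_ahead S y \<in> arc_res y ` S" "res_behind S y \<in> (\<lambda>u. arc_res u y) ` S"
    unfolding res_ahead_def res_behind_def using fin S(2) by (auto intro!: Min_in)
  then obtain u v where u: "u \<in> S" "res_behind S y = arc_res u y"
    and v: "v \<in> S" "res_ahead S y = arc_res y v" by auto
  have ne: "x < n" "x \<noteq> y" if "x \<in> S" for x
    using S y that by auto
  have behind: "arc_res x y = clockwise_res y n - clockwise_res y (offset n y x)" if "x \<in> S" for x
    using arc_res_commute[of y x] ne[OF that] y by (simp add: arc_res_def)
  show thesis
  proof (rule that)
    fix x assume x: "x \<in> S"
    have "res_ahead S y \<le> arc_res y x" "res_behind S y \<le> arc_res x y"
      unfolding res_ahead_def res_behind_def using fin x by (auto intro!: Min_le)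
    then have "clockwise_res y (offset n y v) \<le> clockwise_res y (offset n y x)" "clockwise_res y (offset n y x) \<le> clockwise_res y (offset n y u)"
      using u v behind[OF x] behind[OF u(1)] by (simp_all add: arc_res_def)
    then show "offset n y v \<le> offset n y x \<and> offset n y x \<le> offset n y u"
      by (simp add: strict_mono_less_eq[OF strict_mono_clockwise_res])
  qed (use u v ne[of u] ne[of v] y behind offset_eq_0_iff[of y n u] offset_eq_0_iff[of y n v] in
      \<open>auto simp: arc_res_def offset_less add_offset\<close>)
qed

lemma green_at_source:
  assumes "S \<subseteq> {..<n}" "S \<noteq> {}" "y < n" "y \<notin> S"
  shows "green S y y = node_variance S y"
proof -
  obtain p q where "p < n" 
    "res_behind S y = clockwise_res y n - clockwise_res y p" "res_ahead S y = clockwise_res y q"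
    using neighbours_exist[OF assms] by metis
  moreover have "0 \<le> clockwise_res y p" "0 \<le> clockwise_res y q"
    using strict_mono_less_eq[OF strict_mono_clockwise_res, of y 0] by simp_all
  ultimately show ?thesis
    using assms by (simp add: green_def Let_def node_variance_def parallel_def arc_res_def)
qed

lemma green_at_leader:
  assumes "S \<subseteq> {..<n}" "S \<noteq> {}" "y < n" "y \<notin> S" "x \<in> S"
  shows "green S y x = 0"
proof -
  obtain p q where pq:
    "res_behind S y = clockwise_res y n - clockwise_res y p" "res_ahead S y = clockwise_res y q"
    "q \<le> offset n y x" "offset n y x \<le> p" 
    using neighbours_exist[OF assms(1-4)] assms(5) by metis
  then have "clockwise_res y q \<le> arc_res y x" "arc_res y x \<le> clockwise_res y p"
    by (simp_all add: arc_res_def strict_mono_less_eq[OF strict_mono_clockwise_res])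
  then show ?thesis
    using pq by (simp add: green_def)
qed

text \<open>
  Kirchhoff's law. In the coordinate \<open>t\<close> the potential is piecewise linear, and away from \<open>y\<close> its kinks
  are at leaders. At any other follower the incoming current therefore equals the outgoing one. At
  \<open>y\<close> the currents are \<open>A / (A + B)\<close> and \<open>B / (A + B)\<close> in the two directions, which add up to 1.
\<close>

lemma green_harmonic:
  assumes S: "S \<subseteq> {..<n}" "S \<noteq> {}" and y: "y < n" "y \<notin> S" and z: "z < n" "z \<notin> S"
  shows "(\<Sum>x<n. laplacian n \<nu> $$ (z, x) * green S y x) = (if z = y then 1 else 0)"
proof -
  obtain p q where p: "0 < p" "p < n" and q: "0 < q" "q < n"
    and behind: "res_behind S y = clockwise_res y n - clockwise_res y p" and ahead: "res_ahead S y = clockwise_res y q"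
    and pq: "(y + p) mod n \<in> S" "(y + q) mod n \<in> S"
    using neighbours_exist[OF S y] by metis
  define D where "D = clockwise_res y"
  define r where "r c = res ((y + c) mod n)" for c
  define A where "A = D n - D p"
  define B where "B = D q"
  define f where "f c = A / (A + B) * max 0 (B - D c) + B / (A + B) * max 0 (A + D c - D n)" for c
  have D_Suc: "D (Suc c) = D c + r c" for c
    by (simp add: D_def r_def)
  have r_pos: "0 < r c" for c
    using n_pos by (simp add: r_def res_pos)
  have D_le: "D c \<le> D d \<longleftrightarrow> c \<le> d" for c d
    by (simp add: D_def strict_mono_less_eq[OF strict_mono_clockwise_res])
  have D_less: "D c < D d \<longleftrightarrow> c < d" for c d
    by (simp add: D_def strict_mono_less[OF strict_mono_clockwise_res])
  have D0: "D 0 = 0" by (simp add: D_def)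
  have pos: "0 < A" "0 < B"
    using D_less[of p n] D_less[of 0 q] p q D0 by (simp_all add: A_def B_def)
  have green: "green S y x = f (offset n y x)" for x
    unfolding green_def Let_def behind ahead f_def A_def B_def D_def arc_res_def ..
  have le: "A \<le> D n" "B \<le> D n"
    using D_le[of q n] D_le[of 0 p] p q D0 by (simp_all add: A_def B_def)
  have f_0: "f 0 = A / (A + B) * B"
    using le pos by (simp add: f_def D0)
  \<comment> \<open>Going around the whole ring leads back to the peak, so the case \<open>c + 1 = n\<close> needs no separate treatment.\<close>
  have f_n: "f n = f 0"
    unfolding f_0 using le pos by (simp add: f_def)
  define c where "c = offset n y z"
  have c: "c < n" "(y + c) mod n = z"
    using y z by (simp_all add: c_def offset_less add_offset)
  have next_z: "green S y ((z + 1) mod n) = f (Suc c)"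
  proof -
    have "(z + 1) mod n = (y + Suc c) mod n"
      using c(2) by (metis Suc_eq_plus1 add_Suc_right mod_Suc_eq)
    then show ?thesis
      using c y f_n by (cases "Suc c = n") (simp_all add: green offset_add del: add_Suc_right)
  qed
  have res_z: "res z = r c"
    using c by (simp add: r_def)
  show ?thesis
  proof (cases c)
    case 0
    then have "z = y" using c y by simp
    have prev: "(z + n - 1) mod n = (y + (n - 1)) mod n"
      using \<open>z = y\<close> n_pos by simp
    have "green S y ((z + n - 1) mod n) = f (n - 1)" "res ((z + n - 1) mod n) = r (n - 1)"
      unfolding prev green r_def using y n_pos by (simp_all only: offset_add diff_less zero_less_one)
    then have eq: "(\<Sum>x<n. laplacian n \<nu> $$ (z, x) * green S y x) =
        (f 0 - f 1) / r 0 + (f 0 - f (n - 1)) / r (n - 1)"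
      unfolding laplacian_row[OF z(1)] next_z res_z using 0 by (simp add: green flip: c_def)
    have "D 1 \<le> D q" "D 1 \<le> D p" "D q \<le> D (n - 1)" "D p \<le> D (n - 1)"
      using p q unfolding D_le by auto
    moreover have "D n = D (n - 1) + r (n - 1)" "D 1 = r 0"
      using D_Suc[of "n - 1"] D_Suc[of 0] D0 n_pos by simp_all
    ultimately have "r 0 \<le> B" "A + r 0 \<le> D n" "B \<le> D n - r (n - 1)" "r (n - 1) \<le> A"
      and D1: "D 1 = r 0" "D (n - 1) = D n - r (n - 1)"
      by (simp_all add: A_def B_def)
    then have "f 1 = A / (A + B) * (B - r 0)" "f (n - 1) = B / (A + B) * (A - r (n - 1))"
      unfolding f_def D1 by simp_all
    moreover have "f 0 = B / (A + B) * A"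
      by (simp add: f_0)
    moreover note f_0
    ultimately have "f 0 - f 1 = A / (A + B) * r 0" "f 0 - f (n - 1) = B / (A + B) * r (n - 1)"
      by (metis right_diff_distrib diff_diff_eq2 add_diff_cancel_left' diff_add_cancel)+
    then have "(f 0 - f 1) / r 0 = A / (A + B)" "(f 0 - f (n - 1)) / r (n - 1) = B / (A + B)"
      using r_pos[of 0] r_pos[of "n - 1"] by simp_all
    moreover have "A / (A + B) + B / (A + B) = 1"
      using pos by (simp flip: add_divide_distrib)
    ultimately have "(\<Sum>x<n. laplacian n \<nu> $$ (z, x) * green S y x) = 1"
      by (simp only: eq)
    then show ?thesis
      using \<open>z = y\<close> by simp
  next
    case (Suc d)
    then have "z \<noteq> y"
      using c_def y by auto
    have prev: "(z + n - 1) mod n = (y + d) mod n"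
    proof -
      have "(z + n - 1) mod n = (z + (n - 1)) mod n"
        using n_pos by simp
      also have "\<dots> = (y + c + (n - 1)) mod n"
        unfolding c(2)[symmetric] by (simp add: mod_add_left_eq)
      also have "y + c + (n - 1) = y + d + n"
        using Suc n_pos by simp
      finally show ?thesis by simp
    qed
    have "green S y ((z + n - 1) mod n) = f d" "res ((z + n - 1) mod n) = r d"
      unfolding prev using y c Suc by (simp_all add: green offset_add r_def)
    then have eq: "(\<Sum>x<n. laplacian n \<nu> $$ (z, x) * green S y x) =
        (f c - f (Suc c)) / r c + (f c - f d) / r d"
      unfolding laplacian_row[OF z(1)] next_z res_z by (simp add: green flip: c_def)
    have "c \<noteq> p" "c \<noteq> q"
      using c z pq by auto
    define g where "g c = max 0 (B - D c)" for c
    define h where "h c = max 0 (A + D c - D n)" for c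
    have "(g c - g (Suc c)) / r c + (g c - g d) / r d = 0"
    proof (cases "c < q")
      case True
      then have "D (Suc c) \<le> D q" "D c \<le> D q" "D d \<le> D q"
        using Suc unfolding D_le by auto
      then show ?thesis
        using r_pos[of c] r_pos[of d] D_Suc[of d] Suc by (simp add: g_def B_def D_Suc)
    next
      case False
      then have "D q \<le> D (Suc c)" "D q \<le> D c" "D q \<le> D d"
        using Suc \<open>c \<noteq> q\<close> unfolding D_le by auto
      then show ?thesis by (simp add: g_def B_def)
    qed
    moreover have "(h c - h (Suc c)) / r c + (h c - h d) / r d = 0"
    proof (cases "c < p")
      case True
      then have "D (Suc c) \<le> D p" "D c \<le> D p" "D d \<le> D p"
        using Suc unfolding D_le by auto
      then show ?thesis by (simp add: h_def A_def)
    next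
      case False
      then have "D p \<le> D (Suc c)" "D p \<le> D c" "D p \<le> D d"
        using Suc \<open>c \<noteq> p\<close> unfolding D_le by auto
      then show ?thesis
        using r_pos[of c] r_pos[of d] D_Suc[of d] Suc by (simp add: h_def A_def D_Suc)
    qed
    moreover have "(f c - f (Suc c)) / r c + (f c - f d) / r d
      = A / (A + B) * ((g c - g (Suc c)) / r c + (g c - g d) / r d)
       + B / (A + B) * ((h c - h (Suc c)) / r c + (h c - h d) / r d)"
      by (simp add: f_def g_def h_def algebra_simps diff_divide_distrib add_divide_distrib)
    ultimately show ?thesis
      using \<open>z \<noteq> y\<close> by (simp add: eq)
  qed
qed

text \<open>
  By \<open>green_harmonic\<close> the Green's function is the inverse of the grounded Laplacian, and its value at
  the source is the effective resistance to the ground.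
\<close>

lemma total_variance_eq:
  assumes S: "S \<subseteq> {..<n}" "S \<noteq> {}"
  shows "total_variance n \<nu> S = 1 / 2 * (\<Sum>x\<in>{..<n} - S. node_variance S x)"
proof -
  define F where "F = {..<n} - S"
  define m where "m = card F"
  define M where "M = submatrix (laplacian n \<nu>) F F"
  \<comment> \<open>\<open>pick F\<close> enumerates the followers in the order of the rows of the submatrix.\<close>
  define G where "G = mat m m (\<lambda>(a, b). green S (pick F b) (pick F a))"
  have F: "finite F" "F \<subseteq> {..<n}" by (auto simp: F_def)
  have dim: "{i. i < n \<and> i \<in> F} = F"
    using F by auto
  have M_eq: "M = mat m m (\<lambda>(a, b). laplacian n \<nu> $$ (pick F a, pick F b))"
  proof -
    have "dim_row (laplacian n \<nu>) = n" "dim_col (laplacian n \<nu>) = n"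
      by (simp_all add: laplacian_def)
    then show ?thesis
      by (simp add: M_def submatrix_def m_def dim)
  qed
  have bij: "bij_betw (pick F) {..<m} F"
    unfolding m_def by (rule bij_betw_pick[OF F(1)])
  have pickF: "pick F a < n" "pick F a \<notin> S" if "a < m" for a
    using bij_betwE[OF bij] that by (auto simp: F_def)
  have "M * G = 1\<^sub>m m"
  proof (rule eq_matI)
    fix a b assume ab: "a < dim_row (1\<^sub>m m :: real mat)" "b < dim_col (1\<^sub>m m :: real mat)"
    then have "(M * G) $$ (a, b) = (\<Sum>c<m. laplacian n \<nu> $$ (pick F a, pick F c) * green S (pick F b) (pick F c))"
      by (simp add: M_eq G_def scalar_prod_def lessThan_atLeast0)
    also have "\<dots> = (\<Sum>x\<in>F. laplacian n \<nu> $$ (pick F a, x) * green S (pick F b) x)"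
      by (rule sum.reindex_bij_betw[OF bij])
    also have "\<dots> = (\<Sum>x<n. laplacian n \<nu> $$ (pick F a, x) * green S (pick F b) x)"
      using green_at_leader[OF S] pickF ab by (intro sum.mono_neutral_left) (auto simp: F_def)
    also have "\<dots> = (if pick F a = pick F b then 1 else 0)"
      using green_harmonic[OF S] pickF ab by simp
    also have "\<dots> = 1\<^sub>m m $$ (a, b)"
      using ab bij by (auto simp: bij_betw_def inj_on_eq_iff)
    finally show "(M * G) $$ (a, b) = 1\<^sub>m m $$ (a, b)" .
  qed (simp_all add: M_eq G_def)
  then have "half_trace_inverse M = 1 / 2 * mat_trace G"
    by (rule half_trace_inverse_eq[rotated 2]) (simp_all add: M_eq G_def)
  also have "mat_trace G = (\<Sum>a<m. green S (pick F a) (pick F a))"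
    by (simp add: mat_trace_def G_def)
  also have "\<dots> = (\<Sum>x\<in>F. green S x x)"
    by (rule sum.reindex_bij_betw[OF bij])
  also have "\<dots> = (\<Sum>x\<in>F. node_variance S x)"
    using green_at_source[OF S] by (intro sum.cong) (auto simp: F_def)
  finally show ?thesis
    by (simp add: total_variance_def M_def F_def)
qed

end

section \<open>Closed walks around the ring\<close>

fun path_sum :: "('a \<Rightarrow> 'a \<Rightarrow> real) \<Rightarrow> 'a list \<Rightarrow> real" where
  "path_sum f [] = 0"
| "path_sum f [u] = 0"
| "path_sum f (u # v # p) = f u v + path_sum f (v # p)"

lemma path_sum_snoc: "path_sum f (p @ [u, v]) = path_sum f (p @ [u]) + f u v"
proof (induction p)
  case (Cons a p)
  then show ?case by (cases p) simp_all
qed simp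

lemma path_sum_Cons: "p \<noteq> [] \<Longrightarrow> path_sum f (u # p) = f u (hd p) + path_sum f p"
  by (cases p) simp_all

lemma path_sum_sum:
  "path_sum (\<lambda>u v. \<Sum>x\<in>A. f x u v) p = (\<Sum>x\<in>A. path_sum (f x) p)"
  by (induction p rule: induct_list012) (simp_all add: sum.distrib)

lemma path_sum_scale: "path_sum (\<lambda>u v. c * f u v) p = c * path_sum f p"
  by (induction p rule: induct_list012) (simp_all add: algebra_simps)

lemma path_sum_cong:
  assumes "successively R p" "\<And>u v. u \<in> set p \<Longrightarrow> v \<in> set p \<Longrightarrow> R u v \<Longrightarrow> f u v = g u v"
  shows "path_sum f p = path_sum g p"
  using assms by (induction p rule: induct_list012) auto

lemma path_sum_nonneg: "(\<And>u v. 0 \<le> f u v) \<Longrightarrow> 0 \<le> path_sum f p"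
  by (induction p rule: induct_list012) auto

text \<open>
  Some step violates \<open>R\<close>; it costs at least \<open>c\<close>, and the others are not negative.
\<close>

lemma path_sum_ge_step:
  assumes "\<And>u v. 0 \<le> f u v"
    and "\<And>u v. u \<in> set p \<Longrightarrow> v \<in> set p \<Longrightarrow> \<not> R u v \<Longrightarrow> c \<le> f u v"
    and "\<not> successively R p"
  shows "c \<le> path_sum f p"
  using assms(2,3)
proof (induction p rule: induct_list012)
  case (3 u v p)
  show ?case
  proof (cases "R u v")
    case True
    then have "c \<le> path_sum f (v # p)"
      using 3 by auto
    then show ?thesis
      using assms(1)[of u v] by simp
  next
    case False
    then have "c \<le> f u v"
      using 3 by simp
    then show ?thesis
      using path_sum_nonneg[of f "v # p", OF assms(1)] by simp
  qed
qed simp_all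

context ring_network
begin

text \<open>
  The variance of the arc between the leaders \<open>u\<close> and \<open>v\<close>: the interior nodes are joined to the ground
  at its two ends only.
\<close>

definition arc_cost :: "nat \<Rightarrow> nat \<Rightarrow> real" where
  "arc_cost u v = 1 / 2 * (\<Sum>x\<in>arc_interior n u v. parallel (arc_res u x) (arc_res x v))"

lemma res_behind_le: "S \<subseteq> {..<n} \<Longrightarrow> u \<in> S \<Longrightarrow> res_behind S x \<le> arc_res u x"
  using finite_subset[of S "{..<n}"] by (auto simp: res_behind_def intro!: Min_le)

lemma res_ahead_le: "S \<subseteq> {..<n} \<Longrightarrow> v \<in> S \<Longrightarrow> res_ahead S x \<le> arc_res x v"
  using finite_subset[of S "{..<n}"] by (auto simp: res_ahead_def intro!: Min_le)

lemma res_behind_ge: "S \<subseteq> {..<n} \<Longrightarrow> S \<noteq> {} \<Longrightarrow> (\<And>w. w \<in> S \<Longrightarrow> r \<le> arc_res w x) \<Longrightarrow> r \<le> res_behind S x"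
  using finite_subset[of S "{..<n}"] by (auto simp: res_behind_def)

lemma res_ahead_ge: "S \<subseteq> {..<n} \<Longrightarrow> S \<noteq> {} \<Longrightarrow> (\<And>w. w \<in> S \<Longrightarrow> r \<le> arc_res x w) \<Longrightarrow> r \<le> res_ahead S x"
  using finite_subset[of S "{..<n}"] by (auto simp: res_ahead_def)

lemma res_pos_outside:
  assumes "S \<subseteq> {..<n}" "S \<noteq> {}" "x < n" "x \<notin> S"
  shows "0 < res_behind S x" "0 < res_ahead S x"
proof -
  have fin: "finite S" using assms(1) finite_subset by blast
  then have "res_behind S x \<in> (\<lambda>u. arc_res u x) ` S" "res_ahead S x \<in> arc_res x ` S"
    using assms(2) by (simp_all only: res_behind_def res_ahead_def Min_in finite_imageI image_is_empty not_False_eq_True)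
  then show "0 < res_behind S x" "0 < res_ahead S x"
    using assms by (auto intro!: arc_res_pos)
qed

lemma node_variance_nonneg:
  "S \<subseteq> {..<n} \<Longrightarrow> S \<noteq> {} \<Longrightarrow> x < n \<Longrightarrow> x \<notin> S \<Longrightarrow> 0 \<le> node_variance S x"
  using res_pos_outside[of S x] by (auto simp: node_variance_def intro: parallel_nonneg)

text \<open>
  New leaders are closer or equally close on both sides of every remaining follower, and they remove
  the contributions of the nodes that become leaders.
\<close>

lemma total_variance_antimono:
  assumes "S \<subseteq> S'" "S' \<subseteq> {..<n}" "S \<noteq> {}"
  shows "total_variance n \<nu> S' \<le> total_variance n \<nu> S"
proof -
  have S: "S \<subseteq> {..<n}" "S' \<noteq> {}" using assms by auto
  have "(\<Sum>x\<in>{..<n} - S'. node_variance S' x) \<le> (\<Sum>x\<in>{..<n} - S'. node_variance S x)"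
  proof (rule sum_mono)
    fix x assume "x \<in> {..<n} - S'"
    then show "node_variance S' x \<le> node_variance S x"
      unfolding node_variance_def using assms S
      by (intro parallel_mono res_behind_ge res_ahead_ge res_behind_le res_ahead_le res_pos_outside) auto
  qed
  also have "\<dots> \<le> (\<Sum>x\<in>{..<n} - S. node_variance S x)"
    using assms S by (intro sum_mono2 node_variance_nonneg) auto
  finally show ?thesis
    using assms S by (simp add: total_variance_eq)
qed

text \<open>
  The ends of an arc that crosses \<open>x\<close> are leaders, though not necessarily the nearest ones.
\<close>

lemma node_variance_le_arc:
  assumes "S \<subseteq> {..<n}" "u \<in> S" "v \<in> S" "x < n" "x \<notin> S"
  shows "node_variance S x \<le> parallel (arc_res u x) (arc_res x v)"
  unfolding node_variance_def using assms
  by (intro parallel_mono res_behind_le res_ahead_le res_pos_outside) auto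

text \<open>
  Each unvisited node \<open>x\<close> is crossed by a step. Otherwise the offset from \<open>x\<close> would strictly increase
  along the walk, which is impossible as the walk is closed. Both ends of the crossing step belong to
  the set, so they are at least as far from \<open>x\<close> as the nearest members. There is no equality in
  general, because a node may be crossed several times or by a step over other members.
\<close>

lemma total_variance_le_closed_walk:
  assumes p: "set p \<subseteq> {..<n}" "2 \<le> length p" "hd p = last p" "successively (\<noteq>) p"
  shows "total_variance n \<nu> (set p) \<le> path_sum arc_cost p"
proof -
  define S where "S = set p"
  have S: "S \<subseteq> {..<n}" "S \<noteq> {}" using p by (auto simp: S_def)
  \<comment> \<open>The share of \<open>x\<close> in the cost of a step; exchanging the sums over nodes and steps isolates it.\<close>
  define f where "f x u v = (if x \<in> arc_interior n u v then parallel (arc_res u x) (arc_res x v) else 0)" for x u v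
  have f_nonneg: "0 \<le> f x u v" for x u v
    by (simp add: f_def parallel_nonneg arc_res_nonneg)
  have "node_variance S x \<le> path_sum (f x) p" if x: "x \<in> {..<n} - S" for x
  proof (rule path_sum_ge_step)
    let ?R = "\<lambda>u v. u = v \<or> offset n x u < offset n x v"
    fix u v assume uv: "u \<in> set p" "v \<in> set p" "\<not> ?R u v"
    then have "u < n" "v < n" "x \<noteq> u" "x \<noteq> v" "u \<noteq> v"
      using S x by (auto simp: S_def)
    moreover have "offset n x u \<noteq> offset n x v"
      using calculation x add_offset[of x n u] add_offset[of x n v] by auto
    ultimately have "x \<in> arc_interior n u v"
      using x uv by (auto simp: arc_interior_iff offset_eq split: if_splits)
    then show "node_variance S x \<le> f x u v"
      using node_variance_le_arc[of S u v x] S uv x by (simp add: f_def S_def)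
  next
    show "\<not> successively (\<lambda>u v. u = v \<or> offset n x u < offset n x v) p"
    proof
      assume "successively (\<lambda>u v. u = v \<or> offset n x u < offset n x v) p"
      then have "successively (\<lambda>u v. offset n x u < offset n x v) p"
        using p(4) by (induction p rule: induct_list012) auto
      then have "sorted_wrt (\<lambda>u v. offset n x u < offset n x v) p"
        by (subst (asm) successively_conv_sorted_wrt) (auto intro: transpI)
      then show False
        using p(2,3) by (cases p) (auto split: if_splits)
    qed
  qed (rule f_nonneg)
  then have "(\<Sum>x\<in>{..<n} - S. node_variance S x) \<le> (\<Sum>x\<in>{..<n} - S. path_sum (f x) p)"
    by (intro sum_mono) auto
  also have "\<dots> \<le> (\<Sum>x<n. path_sum (f x) p)"
    by (intro sum_mono2 path_sum_nonneg f_nonneg) auto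
  also have "\<dots> = path_sum (\<lambda>u v. \<Sum>x<n. f x u v) p"
    by (simp add: path_sum_sum)
  also have "1 / 2 * \<dots> = path_sum (\<lambda>u v. 1 / 2 * (\<Sum>x<n. f x u v)) p"
    by (simp only: path_sum_scale)
  also have "\<dots> = path_sum arc_cost p"
  proof (rule path_sum_cong[OF p(4)])
    fix u v assume "u \<in> set p" "v \<in> set p"
    then have "u < n" "v < n" using p by auto
    then have "{..<n} \<inter> arc_interior n u v = arc_interior n u v"
      by (auto simp: arc_interior_iff)
    then show "1 / 2 * (\<Sum>x<n. f x u v) = arc_cost u v"
      by (simp add: f_def arc_cost_def sum.If_cases)
  qed
  finally show ?thesis
    using S by (simp add: total_variance_eq flip: S_def)
qed

text \<open>
  When no leader lies inside the arc, its ends are the nearest leaders of all its interior nodes.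
\<close>

lemma arc_cost_le_gap:
  assumes S: "S \<subseteq> {..<n}" and uv: "u \<in> S" "v \<in> S" and gap: "S \<inter> arc_interior n u v = {}"
  shows "arc_cost u v \<le> 1 / 2 * (\<Sum>x\<in>arc_interior n u v. node_variance S x)"
proof -
  have "u < n" "v < n" using S uv by auto
  have "parallel (arc_res u x) (arc_res x v) \<le> node_variance S x" if "x \<in> arc_interior n u v" for x
  proof -
    have x: "x < n" "0 < offset n u x" "offset n u x < offset n u v"
      using that \<open>u < n\<close> \<open>v < n\<close> by (auto simp: arc_interior_iff)
    then have "x \<noteq> u" "x \<noteq> v" using \<open>u < n\<close> by auto
    have gap': "(w = u \<or> offset n u v \<le> offset n u w) \<and> w < n" if "w \<in> S" for w
    proof -
      have "w < n" using that S by auto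
      moreover have "w \<notin> arc_interior n u v" using gap that by auto
      ultimately show ?thesis
        using \<open>u < n\<close> \<open>v < n\<close> offset_eq_0_iff[of u n w] by (auto simp: arc_interior_iff)
    qed
    show ?thesis
      unfolding node_variance_def
    proof (intro parallel_mono res_behind_ge res_ahead_ge)
      fix w assume w: "w \<in> S"
      note gap = gap'[OF w]
      have "offset n w u \<le> offset n w x"
        using gap x \<open>u < n\<close> \<open>v < n\<close> by (auto simp: offset_eq split: if_splits)
      then show "arc_res u x \<le> arc_res w x"
        using arc_res_trans[of w u x] arc_res_nonneg[of w u] gap x \<open>u < n\<close> by simp
      have "offset n x v \<le> offset n x w"
        using gap x \<open>u < n\<close> \<open>v < n\<close> by (auto simp: offset_eq split: if_splits)
      then show "arc_res x v \<le> arc_res x w"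
        using arc_res_trans[of x v w] arc_res_nonneg[of v w] gap x \<open>v < n\<close> by simp
    qed (use S uv x \<open>x \<noteq> u\<close> \<open>x \<noteq> v\<close> \<open>u < n\<close> \<open>v < n\<close> in \<open>auto intro!: arc_res_pos\<close>)
  qed
  then show ?thesis
    unfolding arc_cost_def by (intro mult_left_mono sum_mono) auto
qed

text \<open>
  The partial tour from \<open>u\<close> is charged to the followers that come after \<open>u\<close>, counted clockwise from
  \<open>i\<close>. Each step skips no leader and pays exactly for the gap that it crosses.
\<close>

lemma clockwise_walk_le:
  assumes S: "S \<subseteq> {..<n}" and i: "i \<in> S"
    and "sorted_wrt (\<lambda>a b. offset n i a < offset n i b) (u # q)" "set (u # q) \<subseteq> S"
    and "\<And>w. w \<in> S \<Longrightarrow> offset n i u \<le> offset n i w \<Longrightarrow> w \<in> set (u # q)"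
  shows "path_sum arc_cost (u # q @ [i])
    \<le> 1 / 2 * (\<Sum>x | x \<in> {..<n} - S \<and> offset n i u < offset n i x. node_variance S x)"
  using assms(3-)
proof (induction q arbitrary: u)
  case Nil
  have lt: "u < n" "i < n" using Nil S i by auto
  have "arc_interior n u i \<subseteq> {x \<in> {..<n}. offset n i u < offset n i x}"
    using lt by (auto simp: arc_interior_iff offset_eq split: if_splits)
  moreover from this have gap: "S \<inter> arc_interior n u i = {}"
    using Nil(3) by fastforce
  ultimately have "(\<Sum>x\<in>arc_interior n u i. node_variance S x) \<le>
      (\<Sum>x | x \<in> {..<n} - S \<and> offset n i u < offset n i x. node_variance S x)"
    using S i by (intro sum_mono2 node_variance_nonneg) auto
  then show ?case
    using arc_cost_le_gap[OF S _ i gap] Nil(2) by simp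
next
  case (Cons v q)
  have lt: "u < n" "v < n" "i < n" using Cons S i by auto
  let ?X = "\<lambda>u. {x. x \<in> {..<n} - S \<and> offset n i u < offset n i x}"
  have uv: "offset n i u < offset n i v"
    using Cons(2) by simp
  have int: "x \<in> arc_interior n u v \<longleftrightarrow> x < n \<and> offset n i u < offset n i x \<and> offset n i x < offset n i v" for x
    using uv offset_less[of i n x] offset_less[of i n v] lt
    by (auto simp: arc_interior_iff offset_diff[of i n u] split: if_splits)
  have gap: "S \<inter> arc_interior n u v = {}"
  proof -
    have False if "w \<in> S" "offset n i u < offset n i w" "offset n i w < offset n i v" for w
    proof -
      have "w \<in> set (u # v # q)" using Cons(4)[of w] that by simp
      then show False using that Cons(2) by auto
    qed
    then show ?thesis by (auto simp: int)
  qed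
  have "path_sum arc_cost (v # q @ [i]) \<le> 1 / 2 * (\<Sum>x\<in>?X v. node_variance S x)"
  proof (rule Cons.IH)
    fix w assume w: "w \<in> S" "offset n i v \<le> offset n i w"
    with uv Cons(4)[of w] show "w \<in> set (v # q)" by auto
  qed (use Cons in auto)
  moreover have "arc_cost u v \<le> 1 / 2 * (\<Sum>x\<in>arc_interior n u v. node_variance S x)"
    using Cons(3) by (intro arc_cost_le_gap[OF S _ _ gap]) auto
  moreover have "(\<Sum>x\<in>arc_interior n u v \<union> ?X v. node_variance S x) \<le> (\<Sum>x\<in>?X u. node_variance S x)"
    using gap uv S i by (intro sum_mono2 node_variance_nonneg) (auto simp: int)
  moreover have "(\<Sum>x\<in>arc_interior n u v \<union> ?X v. node_variance S x)
      = (\<Sum>x\<in>arc_interior n u v. node_variance S x) + (\<Sum>x\<in>?X v. node_variance S x)"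
  proof (rule sum.union_disjoint)
    show "finite (arc_interior n u v)"
      by (rule finite_subset[of _ "{..<n}"]) (auto simp: int)
  qed (auto simp: int)
  ultimately show ?case by simp
qed

text \<open>
  Sorting the leaders by their offset from \<open>i\<close> gives the order in which they are visited.
\<close>

lemma clockwise_tour:
  assumes S: "S \<subseteq> {..<n}" and i: "i \<in> S"
  obtains q where "set q = S - {i}" "length q = card S - 1" "distinct q"
    "path_sum arc_cost (i # q @ [i]) \<le> total_variance n \<nu> S"
proof
  define T where "T = offset n i ` (S - {i})"
  \<comment> \<open>The start \<open>i\<close> has offset 0 and is left out.\<close>
  define q where "q = map (\<lambda>c. (i + c) mod n) (sorted_list_of_set T)"
  have "i < n" using S i by auto
  have "finite S" using S finite_subset by blast
  then have fin: "finite T" by (simp add: T_def)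
  have T: "c < n" "0 < c" if "c \<in> T" for c
    using that S \<open>i < n\<close> offset_eq_0_iff[of i n] by (auto simp: T_def offset_less intro!: gr0I)
  have node: "(\<lambda>c. (i + c) mod n) ` T = S - {i}"
    using S \<open>i < n\<close> by (force simp: T_def image_image add_offset)
  show set_q: "set q = S - {i}"
    using fin node by (simp add: q_def)
  have off: "offset n i ((i + c) mod n) = c" if "c \<in> T" for c
    using T[OF that] \<open>i < n\<close> by (simp add: offset_add)
  have "inj_on (offset n i) (S - {i})"
    using S \<open>i < n\<close> by (intro inj_on_inverseI[of _ "\<lambda>c. (i + c) mod n"]) (auto simp: add_offset)
  then have "card T = card S - 1"
    using \<open>finite S\<close> i by (simp add: T_def card_image)
  then show "length q = card S - 1"
    by (simp add: q_def)
  show "distinct q"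
    unfolding q_def distinct_map using fin off
    by (auto intro!: inj_on_inverseI[of _ "offset n i"])
  have sorted: "sorted_wrt (\<lambda>a b. offset n i a < offset n i b) q"
    unfolding q_def sorted_wrt_map
    by (rule sorted_wrt_mono_rel[OF _ strict_sorted_list_of_set]) (use fin off in auto)
  have "path_sum arc_cost (i # q @ [i]) \<le>
     1 / 2 * (\<Sum>x | x \<in> {..<n} - S \<and> offset n i i < offset n i x. node_variance S x)"
  proof (rule clockwise_walk_le[OF S i])
    have "0 < offset n i x" if "x \<in> set q" for x
      using that set_q S \<open>i < n\<close> offset_eq_0_iff[of i n x] by (auto intro!: gr0I)
    with sorted show "sorted_wrt (\<lambda>a b. offset n i a < offset n i b) (i # q)"
      using \<open>i < n\<close> by simp
  qed (use set_q i in auto)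
  also have "{x. x \<in> {..<n} - S \<and> offset n i i < offset n i x} = {..<n} - S"
    using i \<open>i < n\<close> offset_eq_0_iff[of i n] by (auto intro!: gr0I)
  finally show "path_sum arc_cost (i # q @ [i]) \<le> total_variance n \<nu> S"
    using S i by (subst total_variance_eq) auto
qed

end

section \<open>The weights computed by elimination\<close>

text \<open>
  The matrix is the Laplacian of a chain of resistors \<open>r\<^sub>0, \<dots>, r\<^sub>m\<close> grounded at both ends. Eliminating
  the nodes before \<open>j\<close> replaces the chain behind \<open>j\<close> by one resistor, connected in series, of
  resistance \<open>r\<^sub>0 + \<dots> + r\<^sub>j\<close>. The pivot is the sum of its conductance and of that of the next
  edge.
\<close>

lemma result_pivots:
  assumes pos: "\<And>j. j \<le> m \<Longrightarrow> 0 < r j"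
    and a: "\<And>j. j < m \<Longrightarrow> a ! j = 1 / r j + 1 / r (Suc j)"
    and b: "\<And>j. Suc j < m \<Longrightarrow> b ! j = - (1 / r (Suc j))"
  shows "result (pivots m a b) = map (\<lambda>j. 1 / r (Suc j) + 1 / (\<Sum>i\<le>j. r i)) [0..<m]"
proof -
  let ?d = "\<lambda>j. 1 / r (Suc j) + 1 / (\<Sum>i\<le>j. r i)"
  let ?f = "\<lambda>j ds. do {
     x \<leftarrow> op (a ! j);
     branch (op (j = 0))
       (op (ds @ [x]))
       (do {
         j' \<leftarrow> op (j - 1);
         y \<leftarrow> op (b ! j');
         d \<leftarrow> op (ds ! j');
         z \<leftarrow> op (y * y);
         q \<leftarrow> op (z / d);
         r \<leftarrow> op (x - q);
         op (ds @ [r])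
       })
   }"
  have "result (loop h ?f []) = map ?d [0..<h]" if "h \<le> m" for h
    using that
  proof (induction h)
    case (Suc h)
    then have IH: "result (loop h ?f []) = map ?d [0..<h]" by simp
    show ?case
    proof (cases h)
      case 0
      then show ?thesis using Suc a[of 0] by simp
    next
      case (Suc j)
      let ?R = "\<Sum>i\<le>j. r i"
      have R: "0 < ?R" "0 < r h"
        using Suc \<open>Suc h \<le> m\<close> by (auto intro!: sum_pos pos)
      have "b ! j = - (1 / r h)" "?d j = (?R + r h) / (r h * ?R)"
        using b[of j] Suc \<open>Suc h \<le> m\<close> R by (simp_all add: field_simps)
      then have "b ! j * b ! j / ?d j = (1 / r h) * (?R / (?R + r h))"
        using R by simp
      also have "\<dots> = 1 / r h - 1 / (?R + r h)"
        using R by (simp add: field_simps)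
      finally have "a ! h - b ! j * b ! j / ?d j = ?d h"
        using a[of h] Suc \<open>Suc h \<le> m\<close> by (simp add: add.commute)
      moreover have "map ?d [0..<h] ! j = ?d j"
        using Suc by (simp del: upt_Suc)
      moreover have "result (?f h ds) = ds @ [a ! h - b ! j * b ! j / ds ! j]" for ds
        using Suc by simp
      moreover have "result (loop (Suc h) ?f []) = result (?f h (map ?d [0..<h]))"
        using IH by (simp only: result_loop_Suc)
      ultimately show ?thesis
        by (simp only: upt_Suc_append map_append list.map zero_le)
    qed
  qed simp
  then show ?thesis
    by (simp add: pivots_def)
qed

text \<open>
  The pivots from both directions count the two edges at \<open>j\<close>, and subtracting the diagonal entry
  removes these: what is left are the conductances from \<open>j\<close> to the two ends, of which the
  reciprocal is the resistance in parallel. The reversed arrays describe the chain with the reversed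
  resistances \<open>r (m - j)\<close>.
\<close>

lemma result_tridiagonal_trace_inverse:
  assumes pos: "\<And>j. j \<le> m \<Longrightarrow> 0 < r j"
    and a: "\<And>j. j < m \<Longrightarrow> a ! j = 1 / r j + 1 / r (Suc j)"
    and b: "\<And>j. Suc j < m \<Longrightarrow> b ! j = - (1 / r (Suc j))"
  shows "result (tridiagonal_trace_inverse m a b)
    = (\<Sum>j<m. parallel (\<Sum>i\<le>j. r i) (\<Sum>i\<in>{Suc j..m}. r i))"
proof -
  define ds where "ds = result (pivots m a b)"
  define ra where "ra = result (reverse_array m a)"
  define rb where "rb = result (reverse_array (m - 1) b)"
  define es where "es = result (reverse_array m (result (pivots m ra rb)))"
  define r' where "r' j = r (m - j)" for j
  have ds: "ds = map (\<lambda>j. 1 / r (Suc j) + 1 / (\<Sum>i\<le>j. r i)) [0..<m]"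
    unfolding ds_def by (rule result_pivots) (use assms in auto)
  have "result (pivots m ra rb) = map (\<lambda>j. 1 / r' (Suc j) + 1 / (\<Sum>i\<le>j. r' i)) [0..<m]"
  proof (rule result_pivots)
    fix j assume "j < m"
    then show "ra ! j = 1 / r' j + 1 / r' (Suc j)"
      using a[of "m - 1 - j"] by (simp add: ra_def r'_def Suc_diff_Suc)
  next
    fix j assume "Suc j < m"
    moreover from this have "j < m - 1" by simp
    ultimately show "rb ! j = - (1 / r' (Suc j))"
      using b[of "m - 2 - j"] by (simp add: rb_def r'_def Suc_diff_Suc numeral_2_eq_2)
  qed (simp add: r'_def pos)
  then have es: "es ! j = 1 / r j + 1 / (\<Sum>i\<in>{Suc j..m}. r i)" if "j < m" for j
  proof -
    have "(\<Sum>i\<le>m - 1 - j. r' i) = (\<Sum>i\<in>{Suc j..m}. r i)"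
      using that unfolding r'_def
      by (intro sum.reindex_bij_witness[of _ "\<lambda>i. m - i" "\<lambda>i. m - i"]) auto
    then show ?thesis
      using that \<open>result (pivots m ra rb) = _\<close>
      by (simp add: es_def r'_def Suc_diff_Suc)
  qed
  have entry: "1 / (ds ! j + es ! j - a ! j) = parallel (\<Sum>i\<le>j. r i) (\<Sum>i\<in>{Suc j..m}. r i)"
    if "j < m" for j
  proof -
    have "0 < (\<Sum>i\<le>j. r i)" "0 < (\<Sum>i\<in>{Suc j..m}. r i)"
      using that by (auto intro!: sum_pos pos)
    then show ?thesis
      using that a[of j] by (simp add: ds es parallel_def field_simps)
  qed
  let ?f = "\<lambda>j acc. do {
       d \<leftarrow> op (ds ! j);
       e \<leftarrow> op (es ! j);
       x \<leftarrow> op (a ! j);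
       s \<leftarrow> op (d + e);
       t \<leftarrow> op (s - x);
       r \<leftarrow> op (1 / t);
       op (acc + r)
     }"
  have "result (loop h ?f 0) = (\<Sum>j<h. 1 / (ds ! j + es ! j - a ! j))" for h
    by (induction h) simp_all
  moreover have "result (tridiagonal_trace_inverse m a b) = result (loop m ?f 0)"
    by (simp only: tridiagonal_trace_inverse_def result_bind result_op ds_def es_def ra_def rb_def)
  ultimately show ?thesis
    by (simp add: entry)
qed

context ring_network
begin

lemma result_laplacian_array:
  assumes "i < n"
  defines "L \<equiv> result (laplacian_array n \<nu>)"
  shows "L ! i ! i = 1 / res i + 1 / res ((i + n - 1) mod n)"
    and "L ! i ! ((i + 1) mod n) = - (1 / res i)"
proof -
  have "(i + 1) mod n \<noteq> i" "(i + 1) mod n < n"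
    using assms(1) three_le by (auto simp: mod_if)
  then show "L ! i ! i = 1 / res i + 1 / res ((i + n - 1) mod n)"
    and "L ! i ! ((i + 1) mod n) = - (1 / res i)"
    using assms(1) noise_pred[OF assms(1)] by (simp_all add: L_def laplacian_array_def res_def)
qed

text \<open>
  The interior of the arc from \<open>u\<close> to \<open>v\<close> is a chain of \<open>m\<close> nodes and \<open>m + 1\<close> edges, of which edge
  \<open>j\<close> is the one that leaves the node at offset \<open>j\<close> from \<open>u\<close>.
\<close>

lemma result_arc_weight:
  assumes uv: "u < n" "v < n" "u \<noteq> v"
  shows "result (arc_weight n (result (laplacian_array n \<nu>)) u v) = arc_cost u v"
proof -
  define L where "L = result (laplacian_array n \<nu>)"
  define m where "m = offset n u v - 1"
  have m: "offset n u v = Suc m" "Suc m < n"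
    using uv offset_eq_0_iff[of u n v] offset_less[of u n v] by (auto simp: m_def)
  define r where "r j = res ((u + j) mod n)" for j
  define a where "a = map (\<lambda>j. L ! ((u + 1 + j) mod n) ! ((u + 1 + j) mod n)) [0..<m]"
  define b where "b = map (\<lambda>j. L ! ((u + 1 + j) mod n) ! ((u + 1 + j + 1) mod n)) [0..<m - 1]"
  have a: "a ! j = 1 / r j + 1 / r (Suc j)" if "j < m" for j
  proof -
    have "((u + 1 + j) mod n + n - 1) mod n = (u + j) mod n"
    proof -
      have "((u + 1 + j) mod n + n - 1) mod n = ((u + 1 + j) mod n + (n - 1)) mod n"
        using n_pos by simp
      also have "\<dots> = (u + 1 + j + (n - 1)) mod n"
        by (rule mod_add_left_eq)
      also have "u + 1 + j + (n - 1) = u + j + n"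
        using n_pos by simp
      finally show ?thesis by simp
    qed
    then show ?thesis
      using that n_pos result_laplacian_array(1)[of "(u + 1 + j) mod n"]
      by (simp add: a_def L_def r_def)
  qed
  have b: "b ! j = - (1 / r (Suc j))" if "Suc j < m" for j
    using that n_pos result_laplacian_array(2)[of "(u + 1 + j) mod n"]
    by (simp add: b_def L_def r_def mod_Suc_eq less_diff_conv)
  have m_prog: "(v + n - u) mod n - 1 = m"
    by (simp add: m_def offset_def)
  have "result (arc_weight n L u v) = result (tridiagonal_trace_inverse m a b) / 2"
    by (simp only: arc_weight_def result_bind result_op result_array_of result_read2 m_prog a_def b_def)
  also have "result (tridiagonal_trace_inverse m a b)
      = (\<Sum>j<m. parallel (\<Sum>i\<le>j. r i) (\<Sum>i\<in>{Suc j..m}. r i))"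
    by (rule result_tridiagonal_trace_inverse) (use a b n_pos in \<open>auto simp: r_def res_pos\<close>)
  also have "\<dots> = (\<Sum>j<m. parallel (arc_res u ((u + Suc j) mod n)) (arc_res ((u + Suc j) mod n) v))"
  proof (intro sum.cong refl)
    fix j assume j: "j \<in> {..<m}"
    define x where "x = (u + Suc j) mod n"
    have x: "x < n" "offset n u x = Suc j"
      using j m uv n_pos unfolding x_def by (simp_all only: offset_add mod_less_divisor lessThan_iff)
    have "arc_res u v = (\<Sum>i<Suc m. r i)" "arc_res u x = (\<Sum>i<Suc j. r i)"
      by (simp_all only: arc_res_def clockwise_res_def m x r_def)
    moreover have "arc_res u v = arc_res u x + arc_res x v"
      using j m x uv by (intro arc_res_trans) auto
    moreover have "(\<Sum>i<Suc m. r i) = (\<Sum>i<Suc j. r i) + (\<Sum>i\<in>{Suc j..m}. r i)"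
    proof -
      \<comment> \<open>The edges of the whole arc: up to \<open>x\<close>, and from \<open>x\<close> on.\<close>
      have split: "{..<Suc m} = {..<Suc j} \<union> {Suc j..m}" using j by auto
      show ?thesis
        unfolding split by (rule sum.union_disjoint) auto
    qed
    ultimately show "parallel (\<Sum>i\<le>j. r i) (\<Sum>i\<in>{Suc j..m}. r i)
        = parallel (arc_res u ((u + Suc j) mod n)) (arc_res ((u + Suc j) mod n) v)"
      unfolding x_def[symmetric] by (simp add: lessThan_Suc_atMost)
  qed
  also have "\<dots> = (\<Sum>x\<in>arc_interior n u v. parallel (arc_res u x) (arc_res x v))"
  proof (rule sum.reindex_bij_betw, unfold bij_betw_def, intro conjI)
    show "inj_on (\<lambda>j. (u + Suc j) mod n) {..<m}"
    proof (rule inj_on_inverseI[of _ "\<lambda>x. offset n u x - 1"])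
      fix j assume "j \<in> {..<m}"
      then have "Suc j < n" using m by simp
      from offset_add[OF uv(1) this] show "offset n u ((u + Suc j) mod n) - 1 = j" by simp
    qed
    have "arc_interior n u v = (\<lambda>j. (u + j) mod n) ` {0<..<Suc m}"
      unfolding arc_interior_def m(1)[unfolded offset_def] by auto
    also have "{0<..<Suc m} = Suc ` {..<m}"
      by (auto simp: image_iff gr0_conv_Suc)
    also have "(\<lambda>j. (u + j) mod n) ` Suc ` {..<m} = (\<lambda>j. (u + Suc j) mod n) ` {..<m}"
      by (simp add: image_image)
    finally show "(\<lambda>j. (u + Suc j) mod n) ` {..<m} = arc_interior n u v" ..
  qed
  finally show ?thesis
    by (simp add: arc_cost_def L_def)
qed

end

section \<open>Bellman-Ford with a bounded number of edges\<close>

definition digraph_walk :: "nat \<Rightarrow> real option list list \<Rightarrow> nat list \<Rightarrow> bool" where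
  "digraph_walk N G p \<longleftrightarrow> set p \<subseteq> {..<N} \<and> successively (\<lambda>u v. G ! u ! v \<noteq> None) p"

definition walk_weight :: "real option list list \<Rightarrow> nat list \<Rightarrow> real" where
  "walk_weight G = path_sum (\<lambda>u v. the (G ! u ! v))"

text \<open>
  The walks represented by the table: the entries of the source are infinite in all rows but the
  first, hence walks that return to it are excluded.
\<close>

definition source_walk :: "nat \<Rightarrow> real option list list \<Rightarrow> nat \<Rightarrow> nat \<Rightarrow> nat list \<Rightarrow> bool" where
  "source_walk N G s v p \<longleftrightarrow>
     digraph_walk N G p \<and> p \<noteq> [] \<and> hd p = s \<and> last p = v \<and> s \<notin> set (tl p)"

text \<open>
  The new entry is a lower bound for all extensions by one edge, and if it is finite, the recorded
  predecessor attains it.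
\<close>

lemma relax_invariant:
  fixes N v :: nat and G :: "real option list list" and D :: bf_row
  defines "r \<equiv> result (relax N G D v)"
  shows "(\<forall>u w. u < N \<longrightarrow> G ! u ! v = Some w \<longrightarrow> fst r \<le> fst (D ! u) + ereal w) \<and>
    (fst r = \<infinity> \<or> (\<exists>u w. snd r = Some u \<and> u < N \<and> G ! u ! v = Some w \<and> fst r = fst (D ! u) + ereal w))"
proof -
  let ?f = "\<lambda>u (best :: ereal, p). do {
     e \<leftarrow> read2 G u v;
     tick;
     case e of
       None \<Rightarrow> ret (best, p)
     | Some w \<Rightarrow> do {
         (d, _) \<leftarrow> op (D ! u);
         c \<leftarrow> op (d + ereal w);
         branch (op (c < best)) (ret (c, Some u)) (ret (best, p))
       }
   }"
  let ?P = "\<lambda>h r. (\<forall>u w. u < h \<longrightarrow> G ! u ! v = Some w \<longrightarrow> fst r \<le> fst (D ! u) + ereal w) \<and>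
    (fst r = \<infinity> \<or> (\<exists>u w. snd r = Some u \<and> u < h \<and> G ! u ! v = Some w \<and> fst r = fst (D ! u) + ereal w))"
  have "?P h (result (loop h ?f (\<infinity>, None)))" for h
  proof (induction h)
    case (Suc h)
    let ?r = "result (loop h ?f (\<infinity>, None))"
    have P: "?P h ?r" by (rule Suc)
    show ?case
    proof (cases "G ! h ! v")
      case None
      then have "result (loop (Suc h) ?f (\<infinity>, None)) = ?r"
        by (simp add: case_prod_unfold)
      moreover have "?P (Suc h) ?r"
        using P None by (auto simp: less_Suc_eq)
      ultimately show ?thesis by simp
    next
      case (Some w)
      show ?thesis
      proof (cases "fst (D ! h) + ereal w < fst ?r")
        case True
        then have *: "result (loop (Suc h) ?f (\<infinity>, None)) = (fst (D ! h) + ereal w, Some h)"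
          using Some by (simp add: case_prod_unfold)
        have "fst (D ! h) + ereal w \<le> fst (D ! u) + ereal w'" if "u < h" "G ! u ! v = Some w'" for u w'
          using P that True by (meson less_imp_le order_trans)
        then show ?thesis
          unfolding * using Some by (auto simp: less_Suc_eq)
      next
        case False
        then have *: "result (loop (Suc h) ?f (\<infinity>, None)) = ?r"
          using Some by (simp add: case_prod_unfold)
        show ?thesis
          unfolding * using P Some False by (auto simp: less_Suc_eq)
      qed
    qed
  qed simp
  from this[of N] show ?thesis
    by (simp add: r_def relax_def)
qed

lemma relax_le:
  "u < N \<Longrightarrow> G ! u ! v = Some w \<Longrightarrow> fst (result (relax N G D v)) \<le> fst (D ! u) + ereal w"
  using relax_invariant by blast

lemma relax_attained:
  assumes "fst (result (relax N G D v)) \<noteq> \<infinity>"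
  obtains u w where "snd (result (relax N G D v)) = Some u" "u < N" "G ! u ! v = Some w"
    "fst (result (relax N G D v)) = fst (D ! u) + ereal w"
  using relax_invariant assms by blast

lemma bf_table_rows:
  fixes N s H :: nat and G :: "real option list list"
  defines "T \<equiv> result (bf_table N G s H)"
  shows "length T = H + 1"
    and "v < N \<Longrightarrow> T ! 0 ! v = (if v = s then (0, None) else (\<infinity>, None))"
    and "m < H \<Longrightarrow> v < N \<Longrightarrow>
      T ! Suc m ! v = (if v = s then (\<infinity>, None) else result (relax N G (T ! m) v))"
proof -
  let ?D0 = "map (\<lambda>v. if v = s then (0::ereal, None::nat option) else (\<infinity>, None)) [0..<N]"
  let ?f = "\<lambda>m Ds. do {
       D \<leftarrow> op (Ds ! m);
       D' \<leftarrow> array_of N (\<lambda>v. branch (op (v = s)) (ret (\<infinity>, None)) (relax N G D v));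
       op (Ds @ [D'])
     }"
  let ?T = "\<lambda>h. result (loop h ?f [?D0])"
  have T: "T = ?T H"
    by (simp add: T_def bf_table_def if_distrib cong: if_cong)
  have len: "length (?T h) = h + 1" for h
    by (induction h) simp_all
  have row: "?T h ! m = ?T m ! m" if "m \<le> h" for h m
    using that
  proof (induction h)
    case (Suc h)
    then show ?case
      using len[of h] by (cases "m = Suc h") (simp_all add: nth_append)
  qed simp
  show "length T = H + 1"
    using len T by simp
  show "T ! 0 ! v = (if v = s then (0, None) else (\<infinity>, None))" if "v < N"
    using row[of 0 H] that by (simp add: T)
  show "T ! Suc m ! v = (if v = s then (\<infinity>, None) else result (relax N G (T ! m) v))" if "m < H" "v < N"
  proof -
    have "T ! m = ?T m ! m" "T ! Suc m = ?T (Suc m) ! Suc m"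
      using row[of m H] row[of "Suc m" H] that by (simp_all only: T)
    then show ?thesis
      using len[of m] that by (simp add: nth_append)
  qed
qed

lemma bf_table_le:
  assumes "source_walk N G s v p" "length p = m + 1" "m \<le> H"
  shows "fst (result (bf_table N G s H) ! m ! v) \<le> ereal (walk_weight G p)"
  using assms
proof (induction m arbitrary: v p)
  case 0
  then obtain x where "p = [x]" by (cases p) auto
  with 0 have "p = [s]" "v = s" "s < N"
    by (auto simp: source_walk_def digraph_walk_def)
  then show ?case
    by (simp add: bf_table_rows walk_weight_def zero_ereal_def)
next
  case (Suc m)
  let ?T = "result (bf_table N G s H)"
  obtain p' where p': "p = p' @ [v]" "length p' = Suc m"
    using Suc.prems by (cases p rule: rev_cases) (auto simp: source_walk_def)
  then obtain q u where q: "p' = q @ [u]"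
    by (cases p' rule: rev_cases) auto
  have p: "p = q @ [u, v]" using p' q by simp
  have "digraph_walk N G (q @ [u])"
    using Suc.prems(1) p' q by (auto simp: source_walk_def digraph_walk_def successively_append_iff)
  then have walk: "source_walk N G s u (q @ [u])"
    using Suc.prems(1) p by (cases q) (auto simp: source_walk_def)
  from Suc.prems(1) p have v: "v \<noteq> s" "v < N" "u < N"
    by (cases q; auto simp: source_walk_def digraph_walk_def)+
  obtain w where w: "G ! u ! v = Some w"
    using Suc.prems(1) p by (auto simp: source_walk_def digraph_walk_def successively_append_iff)
  have "fst (?T ! Suc m ! v) = fst (result (relax N G (?T ! m) v))"
    using v Suc.prems by (simp add: bf_table_rows)
  also have "\<dots> \<le> fst (?T ! m ! u) + ereal w"
    using v w by (intro relax_le)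
  also have "\<dots> \<le> ereal (walk_weight G (q @ [u])) + ereal w"
    using Suc.IH[OF walk] Suc.prems p by (intro add_right_mono) simp
  also have "\<dots> = ereal (walk_weight G p)"
    using w by (simp add: p walk_weight_def path_sum_snoc)
  finally show ?case .
qed

text \<open>
  Ties and infinite entries do not update the pair, so 0 edges means that no walk exists.
\<close>

lemma bf_best_invariant:
  assumes "result (bf_best T t H) = (w, m)"
  shows "\<forall>l \<in> {1..H}. w \<le> fst (T ! l ! t)"
    and "m = 0 \<and> w = \<infinity> \<or> m \<in> {1..H} \<and> w = fst (T ! m ! t) \<and> w \<noteq> \<infinity>"
proof -
  let ?f = "\<lambda>j (best, m). do {
     l \<leftarrow> op (j + 1);
     (d, _) \<leftarrow> read2 T l t;
     branch (op (d < best)) (ret (d, l)) (ret (best, m))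
   }"
  let ?P = "\<lambda>h (w, m). (\<forall>l \<in> {1..h}. w \<le> fst (T ! l ! t)) \<and>
     (m = 0 \<and> w = \<infinity> \<or> m \<in> {1..h} \<and> w = fst (T ! m ! t) \<and> w \<noteq> \<infinity>)"
  have "?P h (result (loop h ?f (\<infinity>, 0)))" for h
  proof (induction h)
    case (Suc h)
    obtain w m where wm: "result (loop h ?f (\<infinity>, 0)) = (w, m)"
      by fastforce
    have "result (loop (Suc h) ?f (\<infinity>, 0))
        = (if fst (T ! Suc h ! t) < w then (fst (T ! Suc h ! t), Suc h) else (w, m))"
      using wm by (simp add: case_prod_unfold)
    then show ?case
      using Suc unfolding wm
      by (auto simp: atLeastAtMostSuc_conv intro: less_imp_le order_trans)
  qed simp
  from this[of H] assms show "\<forall>l \<in> {1..H}. w \<le> fst (T ! l ! t)"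
    and "m = 0 \<and> w = \<infinity> \<or> m \<in> {1..H} \<and> w = fst (T ! m ! t) \<and> w \<noteq> \<infinity>"
    by (auto simp: bf_best_def)
qed

text \<open>
  After \<open>j\<close> rounds the path collected so far leads from the current node to \<open>t\<close> with \<open>j\<close> edges, and its
  weight makes up the difference between the entry for \<open>t\<close> and the entry of the current node in row
  \<open>m - j\<close>. The only finite entry of row 0 belongs to the source, so the path ends there.
\<close>

lemma bf_path_walk:
  fixes N s H :: nat and G :: "real option list list"
  defines "T \<equiv> result (bf_table N G s H)"
  assumes fin: "fst (T ! m ! t) \<noteq> \<infinity>" and "m \<le> H" "t < N"
  shows "source_walk N G s t (result (bf_path T t m))"
    and "fst (T ! m ! t) = ereal (walk_weight G (result (bf_path T t m)))"
proof -
  let ?f = "\<lambda>j (v, path). do {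
       l \<leftarrow> op (m - j);
       (_, p) \<leftarrow> read2 T l v;
       path' \<leftarrow> op (the p # path);
       ret (the p, path')
     }"
  let ?P = "\<lambda>j (v, p). p \<noteq> [] \<and> hd p = v \<and> last p = t \<and> digraph_walk N G p \<and> s \<notin> set (tl p) \<and>
     fst (T ! (m - j) ! v) \<noteq> \<infinity> \<and> fst (T ! m ! t) = fst (T ! (m - j) ! v) + ereal (walk_weight G p)"
  have "?P j (result (loop j ?f (t, [t])))" if "j \<le> m" for j
    using that
  proof (induction j)
    case 0
    then show ?case
      using fin \<open>t < N\<close> by (simp add: digraph_walk_def walk_weight_def flip: zero_ereal_def)
  next
    case (Suc j)
    obtain v p where vp: "result (loop j ?f (t, [t])) = (v, p)"
      by fastforce
    with Suc have P: "?P j (v, p)" by simp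
    define l where "l = m - Suc j"
    have l: "m - j = Suc l" "l < H"
      using Suc.prems \<open>m \<le> H\<close> by (auto simp: l_def)
    have "v < N"
      using P by (cases p) (auto simp: digraph_walk_def)
    have row: "T ! Suc l ! v = (if v = s then (\<infinity>, None) else result (relax N G (T ! l) v))"
      using bf_table_rows(3)[OF l(2) \<open>v < N\<close>] by (simp add: T_def)
    then have "v \<noteq> s"
      using P l by auto
    then have row': "T ! Suc l ! v = result (relax N G (T ! l) v)"
      using row by simp
    obtain u w where u: "snd (T ! Suc l ! v) = Some u" "u < N" "G ! u ! v = Some w"
      "fst (T ! Suc l ! v) = fst (T ! l ! u) + ereal w"
      unfolding row' by (rule relax_attained[of N G "T ! l" v]) (use P l row' in auto)
    have step: "result (loop (Suc j) ?f (t, [t])) = (u, u # p)"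
      using vp u l by (simp add: case_prod_unfold)
    have "walk_weight G (u # p) = w + walk_weight G p"
      using P u by (auto simp: walk_weight_def path_sum_Cons)
    then have "fst (T ! m ! t) = fst (T ! l ! u) + ereal (walk_weight G (u # p))"
      using P u l by (simp add: add.assoc)
    moreover have "fst (T ! l ! u) \<noteq> \<infinity>"
      using P u l by auto
    moreover have "digraph_walk N G (u # p)"
      using P u by (cases p) (auto simp: digraph_walk_def)
    moreover have "s \<notin> set p"
      using P \<open>v \<noteq> s\<close> by (cases p) auto
    ultimately show ?case
      unfolding step using P by (simp add: l_def)
  qed
  from this[of m] obtain p where p: "result (bf_path T t m) = p"
    and P: "p \<noteq> []" "last p = t" "digraph_walk N G p" "s \<notin> set (tl p)"
     "fst (T ! 0 ! hd p) \<noteq> \<infinity>" "fst (T ! m ! t) = fst (T ! 0 ! hd p) + ereal (walk_weight G p)"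
    by (auto simp: bf_path_def case_prod_unfold)
  have "hd p < N"
    using P by (cases p) (auto simp: digraph_walk_def)
  then have row: "T ! 0 ! hd p = (if hd p = s then (0, None) else (\<infinity>, None))"
    by (simp add: T_def bf_table_rows(2))
  then have "hd p = s"
    using P by (auto split: if_splits)
  then show "source_walk N G s t (result (bf_path T t m))"
    and "fst (T ! m ! t) = ereal (walk_weight G (result (bf_path T t m)))"
    using P row by (auto simp: source_walk_def p)
qed

lemma length_bf_path: "length (result (bf_path Ds t m)) = m + 1"
proof -
  have "length (snd (result (loop j (\<lambda>j (v, path). do {
       l \<leftarrow> op (m - j);
       (_, p) \<leftarrow> read2 Ds l v;
       path' \<leftarrow> op (the p # path);
       ret (the p, path')
     }) (t, [t])))) = j + 1" for j
    by (induction j) (auto split: prod.splits)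
  from this[of m] show ?thesis
    by (simp add: bf_path_def case_prod_unfold)
qed

lemma bellman_ford_le:
  assumes "source_walk N G s t p" "2 \<le> length p" "length p \<le> H + 1"
  shows "snd (result (bellman_ford N G s t H)) \<le> ereal (walk_weight G p)"
proof -
  let ?T = "result (bf_table N G s H)"
  obtain w m where wm: "result (bf_best ?T t H) = (w, m)"
    by fastforce
  have "w \<le> fst (?T ! (length p - 1) ! t)"
    using bf_best_invariant(1)[OF wm, rule_format, of "length p - 1"] assms(2,3) by simp linarith
  also have "\<dots> \<le> ereal (walk_weight G p)"
    using assms by (intro bf_table_le) auto
  finally have "w \<le> ereal (walk_weight G p)" .
  with bf_best_invariant(2)[OF wm] show ?thesis
    by (auto simp: bellman_ford_def wm)
qed

lemma bellman_ford_infinity: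
  assumes "result (bellman_ford N G s t H) = (p, \<infinity>)"
  shows "p = []"
proof -
  obtain w m where wm: "result (bf_best (result (bf_table N G s H)) t H) = (w, m)"
    by fastforce
  show ?thesis
    using assms bf_best_invariant(2)[OF wm] by (auto simp: bellman_ford_def wm split: if_splits)
qed

lemma bellman_ford_walk:
  assumes "result (bellman_ford N G s t H) = (p, w)" "w \<noteq> \<infinity>"
    and "t < N"
  shows "source_walk N G s t p" "2 \<le> length p" "length p \<le> H + 1" "w = ereal (walk_weight G p)"
proof -
  let ?T = "result (bf_table N G s H)"
  obtain w' m where wm: "result (bf_best ?T t H) = (w', m)"
    by fastforce
  from assms(1,2) have m: "m \<noteq> 0" "w' = w" "p = result (bf_path ?T t m)"
    by (auto simp: bellman_ford_def wm split: if_splits)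
  then have best: "m \<in> {1..H}" "w = fst (?T ! m ! t)"
    using bf_best_invariant(2)[OF wm] by auto
  show "source_walk N G s t p" "w = ereal (walk_weight G p)"
    using bf_path_walk[of N G s H m t] best assms m by auto
  show "2 \<le> length p" "length p \<le> H + 1"
    using best m by (auto simp: length_bf_path)
qed

section \<open>Optimality of the selected leaders\<close>

lemma result_remove_ends: "result (remove_ends s t ps) = filter (\<lambda>p. p \<noteq> s \<and> p \<noteq> t) ps"
  by (induction ps) auto

lemma successively_if_distinct: "distinct xs \<Longrightarrow> successively (\<noteq>) xs"
  by (induction xs rule: induct_list012) auto

context ring_network
begin

definition weights :: "real list list" where
  "weights = result (weight_table n (result (laplacian_array n \<nu>)))"

lemma weight_table_entry: "u < n \<Longrightarrow> v < n \<Longrightarrow> u \<noteq> v \<Longrightarrow> weights ! u ! v = arc_cost u v"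
  by (simp add: weights_def weight_table_def result_arc_weight)

text \<open>
  Source and target are the two copies \<open>i\<close> and \<open>n\<close> of the candidate leader.
\<close>

lemma leader_digraph_entry:
  assumes "i < n" "u \<le> n" "v \<le> n"
  shows "result (leader_digraph n weights i) ! u ! v =
    (if u = n \<or> v = i \<or> u = v then None
     else if v < n then Some (arc_cost u v)
     else if u = i then None else Some (arc_cost u i))"
  using assms by (auto simp: leader_digraph_def weight_table_entry nth_append)

text \<open>
  Identifying the source with the target turns a walk into a closed walk through \<open>i\<close> of the same
  weight. It visits another node, as there is no edge from the source to the target, and it
  does not return to \<open>i\<close> on the way, as the source has no incoming and the target no outgoing edges.
\<close>

lemma source_walkD:
  assumes i: "i < n" and p: "source_walk (n + 1) (result (leader_digraph n weights i)) i n p"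
  defines "q \<equiv> filter (\<lambda>x. x \<noteq> i \<and> x \<noteq> n) p"
  shows "p = i # q @ [n]" "q \<noteq> []" "set q \<subseteq> {..<n} - {i}" "successively (\<noteq>) (i # q @ [i])"
    "walk_weight (result (leader_digraph n weights i)) p = path_sum arc_cost (i # q @ [i])"
proof -
  define G where "G = result (leader_digraph n weights i)"
  note G = leader_digraph_entry[OF i, folded G_def]
  define R where "R u v \<longleftrightarrow> G ! u ! v \<noteq> None" for u v
  have walk: "set p \<subseteq> {..<n + 1}" "successively R p" "p \<noteq> []" "hd p = i" "last p = n" "i \<notin> set (tl p)"
    using p by (auto simp: source_walk_def digraph_walk_def R_def G_def)
  then have "tl p \<noteq> []"
    using i by (cases p) (auto split: if_splits)
  then obtain q' where q': "p = i # q' @ [n]"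
    using walk by (cases p) (auto intro: append_butlast_last_id[symmetric])
  have R: "u \<noteq> n" "u \<noteq> v" if "R u v" "u \<le> n" "v \<le> n" for u v
    using that by (auto simp: R_def G split: if_splits)
  have succ: "successively R (i # q' @ [n])"
    using walk q' by simp
  have n_notin: "n \<notin> set q'"
  proof
    assume "n \<in> set q'"
    then obtain q1 q2 where "q' = q1 @ n # q2"
      by (auto simp: in_set_conv_decomp)
    then have "successively R ((i # q1) @ [n] @ (q2 @ [n]))"
      using succ by simp
    then have "R n (hd (q2 @ [n]))"
      unfolding successively_append_iff by auto
    moreover have "hd (q2 @ [n]) \<in> set p"
      using q' \<open>q' = _\<close> by (cases q2) auto
    then have "hd (q2 @ [n]) \<le> n"
      using walk(1) by auto
    ultimately show False using R by blast
  qed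
  have i_notin: "i \<notin> set q'" using walk q' by auto
  have "q = q'"
    unfolding q_def q' using n_notin i_notin by (auto simp: filter_id_conv)
  then show p_eq: "p = i # q @ [n]" using q' by simp
  show set_q: "set q \<subseteq> {..<n} - {i}"
    using walk(1) n_notin i_notin \<open>q = q'\<close> q' by (force simp: less_Suc_eq)
  show q_ne: "q \<noteq> []"
  proof
    assume "q = []"
    then have "R i n" using succ \<open>q = q'\<close> by simp
    then show False using i by (simp add: R_def G)
  qed
  then obtain q0 l where l: "q = q0 @ [l]"
    by (cases q rule: rev_cases) auto
  have iq: "successively R (i # q)"
  proof -
    have "successively R ((i # q) @ [n])"
      using succ \<open>q = q'\<close> by simp
    then show ?thesis unfolding successively_append_iff by blast
  qed
  have "successively (\<noteq>) (i # q)"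
  proof (rule successively_mono[OF iq])
    fix u v assume "u \<in> set (i # q)" "v \<in> set (i # q)" "R u v"
    moreover from this have "u \<le> n" "v \<le> n" using i set_q by auto
    ultimately show "u \<noteq> v" using R(2) by blast
  qed
  then have "successively (\<noteq>) ((i # q) @ [i])"
    unfolding successively_append_iff using set_q l by auto
  then show "successively (\<noteq>) (i # q @ [i])" by simp
  let ?f = "\<lambda>u v. the (G ! u ! v)"
  have "path_sum ?f (i # q) = path_sum arc_cost (i # q)"
  proof (rule path_sum_cong[OF iq])
    fix u v assume "u \<in> set (i # q)" "v \<in> set (i # q)" "R u v"
    moreover from this have "u < n" "v < n" using i set_q by auto
    ultimately show "?f u v = arc_cost u v"
      by (auto simp: R_def G split: if_splits)
  qed
  moreover have "?f l n = arc_cost l i"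
    using set_q l i by (auto simp: G)
  ultimately show "walk_weight (result (leader_digraph n weights i)) p = path_sum arc_cost (i # q @ [i])"
    unfolding p_eq walk_weight_def G_def[symmetric]
    using path_sum_snoc[of _ "i # q0" l] by (simp add: l)
qed

text \<open>
  Distinct nodes other than \<open>i\<close> are joined by edges in any order, so each list of them is a walk.
\<close>

lemma source_walkI:
  assumes i: "i < n" and q: "q \<noteq> []" "distinct q" "set q \<subseteq> {..<n} - {i}"
  shows "source_walk (n + 1) (result (leader_digraph n weights i)) i n (i # q @ [n])"
proof -
  define G where "G = result (leader_digraph n weights i)"
  note G = leader_digraph_entry[OF i, folded G_def]
  have "successively (\<lambda>u v. G ! u ! v \<noteq> None) (i # q)"
  proof -
    have "successively (\<lambda>u v. G ! u ! v \<noteq> None) q"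
    proof (rule successively_mono[of "(\<noteq>)"])
      show "successively (\<noteq>) q"
        using q(2) by (rule successively_if_distinct)
    next
      fix u v assume "u \<in> set q" "v \<in> set q" "u \<noteq> v"
      moreover from this have "u < n" "v < n" "v \<noteq> i" using q(3) by auto
      ultimately show "G ! u ! v \<noteq> None" by (simp add: G)
    qed
    moreover have "hd q \<in> set q"
      using q(1) by simp
    ultimately show ?thesis
      using q i by (cases q) (auto simp: G)
  qed
  moreover have "last q < n" "last q \<noteq> i"
    using q(3) last_in_set[OF q(1)] by auto
  then have "G ! last q ! n \<noteq> None"
    using i by (simp add: G)
  ultimately have "successively (\<lambda>u v. G ! u ! v \<noteq> None) ((i # q) @ [n])"
    unfolding successively_append_iff using q by simp
  then show ?thesis
    using q i by (auto simp: source_walk_def digraph_walk_def G_def)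
qed

lemma result_candidate:
  assumes "result (bellman_ford (n + 1) (result (leader_digraph n weights i)) i n k) = (p, w)"
  shows "result (candidate n weights k i) = (i # filter (\<lambda>x. x \<noteq> i \<and> x \<noteq> n) p, w)"
  using assms by (simp add: candidate_def result_remove_ends)

text \<open>
  A walk with at most \<open>k\<close> edges has at most \<open>k - 1\<close> nodes besides its ends. Without a walk, which
  happens for \<open>k = 1\<close>, the set is \<open>{i}\<close>.
\<close>

lemma candidate_feasible:
  assumes i: "i < n" and k: "1 \<le> k"
  shows "feasible_leaders n k (set (fst (result (candidate n weights k i))))"
proof -
  obtain p w where bf: "result (bellman_ford (n + 1) (result (leader_digraph n weights i)) i n k) = (p, w)"
    by fastforce
  let ?q = "filter (\<lambda>x. x \<noteq> i \<and> x \<noteq> n) p"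
  have "set ?q \<subseteq> {..<n} \<and> card (insert i (set ?q)) \<le> k"
  proof (cases "w = \<infinity>")
    case True
    then have "p = []" using bellman_ford_infinity[OF bf[unfolded True]] by simp
    then show ?thesis using k by simp
  next
    case False
    note walk = source_walkD[OF i bellman_ford_walk(1)[OF bf False less_add_one]]
    have "length ?q + 2 \<le> k + 1"
      using bellman_ford_walk(3)[OF bf False less_add_one] walk(1) by (metis length_Cons length_append_singleton add_2_eq_Suc' less_Suc_eq_le lessI)
    then show ?thesis
      using walk(3) card_insert_le_m1[of k "set ?q" i] card_length[of ?q] k by auto
  qed
  then show ?thesis
    using i by (simp add: result_candidate[OF bf] feasible_leaders_def)
qed

text \<open>
  The members of the set are the nodes of the closed walk, at least one of them besides \<open>i\<close>.
\<close>

lemma candidate_weight_ge: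
  assumes i: "i < n" and fin: "snd (result (candidate n weights k i)) \<noteq> \<infinity>"
  defines "S \<equiv> set (fst (result (candidate n weights k i)))"
  shows "ereal (total_variance n \<nu> S) \<le> snd (result (candidate n weights k i))"
    and "2 \<le> card S"
proof -
  obtain p w where bf: "result (bellman_ford (n + 1) (result (leader_digraph n weights i)) i n k) = (p, w)"
    by fastforce
  note cand = result_candidate[OF bf]
  have w: "w \<noteq> \<infinity>" using fin cand by simp
  define q where "q = filter (\<lambda>x. x \<noteq> i \<and> x \<noteq> n) p"
  have S: "S = set (i # q @ [i])"
    by (simp add: S_def cand q_def)
  note walk = source_walkD[OF i bellman_ford_walk(1)[OF bf w less_add_one], folded q_def]
  have "total_variance n \<nu> S \<le> path_sum arc_cost (i # q @ [i])"
    unfolding S using walk i by (intro total_variance_le_closed_walk) auto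
  also have "ereal \<dots> = w"
    using bellman_ford_walk(4)[OF bf w less_add_one] walk by simp
  finally show "ereal (total_variance n \<nu> S) \<le> snd (result (candidate n weights k i))"
    by (simp add: cand)
  have "S = insert i (set q)" "i \<notin> set q" "set q \<noteq> {}"
    using walk by (auto simp: S)
  then have "card S = Suc (card (set q))" "0 < card (set q)"
    by (simp_all add: card_gt_0_iff)
  then show "2 \<le> card S" by linarith
qed

text \<open>
  The tour through \<open>S\<close> has \<open>card S \<le> k\<close> edges, so it competes in the search from \<open>i\<close>.
\<close>

lemma candidate_weight_le:
  assumes S: "feasible_leaders n k S" "2 \<le> card S" and i: "i \<in> S"
  shows "snd (result (candidate n weights k i)) \<le> ereal (total_variance n \<nu> S)"
proof -
  have S': "S \<subseteq> {..<n}" "card S \<le> k" "i < n"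
    using S i by (auto simp: feasible_leaders_def)
  obtain q where q: "set q = S - {i}" "length q = card S - 1" "distinct q"
    "path_sum arc_cost (i # q @ [i]) \<le> total_variance n \<nu> S"
    using clockwise_tour[OF S'(1) i] by metis
  have "q \<noteq> []" using q(2) S by auto
  then have walk: "source_walk (n + 1) (result (leader_digraph n weights i)) i n (i # q @ [n])"
    using q S' by (intro source_walkI) auto
  have filter: "filter (\<lambda>x. x \<noteq> i \<and> x \<noteq> n) (i # q @ [n]) = q"
    using q S' by (auto simp: filter_id_conv)
  obtain p w where bf: "result (bellman_ford (n + 1) (result (leader_digraph n weights i)) i n k) = (p, w)"
    by fastforce
  have "w \<le> ereal (walk_weight (result (leader_digraph n weights i)) (i # q @ [n]))"
    using bellman_ford_le[OF walk, of k] bf q(2) S(2) S'(2) by simp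
  also have "\<dots> = ereal (path_sum arc_cost (i # q @ [i]))"
    using source_walkD(5)[OF S'(3) walk] unfolding filter by simp
  also have "\<dots> \<le> ereal (total_variance n \<nu> S)"
    using q by simp
  finally show ?thesis
    by (simp add: result_candidate[OF bf])
qed

lemma leader_selection_best:
  obtains i where "i < n" "result (leader_selection n \<nu> k) = result (candidate n weights k i)"
    "\<And>j. j < n \<Longrightarrow> snd (result (candidate n weights k i)) \<le> snd (result (candidate n weights k j))"
proof -
  define cs where "cs = map (\<lambda>i. result (candidate n weights k i)) [0..<n]"
  let ?f = "\<lambda>i b. do {
       (_, w) \<leftarrow> op (cs ! i);
       (_, w') \<leftarrow> op (cs ! b);
       branch (op (w < w')) (ret i) (ret b)
     }"
  let ?best = "\<lambda>h. result (loop h ?f 0)"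
  have inv: "?best h < n \<and> (\<forall>j<h. snd (cs ! ?best h) \<le> snd (cs ! j))" if "h \<le> n" for h
    using that
  proof (induction h)
    case (Suc h)
    have "?best (Suc h) = (if snd (cs ! h) < snd (cs ! ?best h) then h else ?best h)"
      by (simp add: case_prod_unfold)
    with Suc show ?case
      by (auto simp: less_Suc_eq intro: less_imp_le order_trans)
  qed (simp add: n_pos)
  have "result (leader_selection n \<nu> k) = cs ! ?best n"
    by (simp only: leader_selection_def result_bind result_op result_array_of weights_def cs_def)
  with inv[of n] show thesis
    by (intro that[of "?best n"]) (auto simp: cs_def)
qed

lemma selected_feasible:
  assumes "1 \<le> k"
  shows "feasible_leaders n k (selected_leaders n \<nu> k)"
  using leader_selection_best[of k] candidate_feasible assms
  by (metis selected_leaders_def)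

text \<open>
  For a feasible set \<open>T\<close> with two or more members, the weight of the best candidate lies between the
  variance of the selected set and that of \<open>T\<close>. The selected set is such a \<open>T\<close> itself, which gives the
  value of the weight. A singleton is enlarged to a set of two, which increases no variance.
\<close>

lemma selected_optimal:
  assumes k: "2 \<le> k"
  defines "S \<equiv> selected_leaders n \<nu> k"
  shows "selected_weight n \<nu> k = ereal (total_variance n \<nu> S)"
    and "feasible_leaders n k S' \<Longrightarrow> total_variance n \<nu> S \<le> total_variance n \<nu> S'"
proof -
  obtain i where i: "i < n" "result (leader_selection n \<nu> k) = result (candidate n weights k i)"
    and best: "\<And>j. j < n \<Longrightarrow> snd (result (candidate n weights k i)) \<le> snd (result (candidate n weights k j))"
    using leader_selection_best by blast
  define w where "w = selected_weight n \<nu> k"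
  have w: "w = snd (result (candidate n weights k i))" and S: "S = set (fst (result (candidate n weights k i)))"
    using i by (simp_all add: w_def S_def selected_weight_def selected_leaders_def)
  have le: "w \<le> ereal (total_variance n \<nu> T)" if T: "feasible_leaders n k T" "2 \<le> card T" for T
  proof -
    obtain j where j: "j \<in> T" using T by (auto simp: feasible_leaders_def)
    then have "j < n" using T by (auto simp: feasible_leaders_def)
    then show ?thesis
      using best[of j] candidate_weight_le[OF T j] w by (metis order_trans)
  qed
  have "w \<noteq> \<infinity>"
    using le[of "{0, 1}"] three_le k by (auto simp: feasible_leaders_def)
  then have ge: "ereal (total_variance n \<nu> S) \<le> w" "2 \<le> card S"
    using candidate_weight_ge[OF i(1), of k] by (simp_all add: w S)
  have feas: "feasible_leaders n k S"
    using selected_feasible k by (simp add: S_def)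
  show "selected_weight n \<nu> k = ereal (total_variance n \<nu> S)"
    using le[OF feas ge(2)] ge(1) by (simp add: w_def antisym)
  show "total_variance n \<nu> S \<le> total_variance n \<nu> S'" if S': "feasible_leaders n k S'"
  proof -
    have sub: "S' \<subseteq> {..<n}" "S' \<noteq> {}" "card S' \<le> k" "finite S'"
      using S' finite_subset[of S' "{..<n}"] by (auto simp: feasible_leaders_def)
    obtain T where T: "feasible_leaders n k T" "2 \<le> card T" "S' \<subseteq> T"
    proof (cases "2 \<le> card S'")
      case False
      then have card: "card S' = 1"
        using sub card_gt_0_iff[of S'] by linarith
      have "\<not> {..<n} \<subseteq> S'"
        using card_mono[OF sub(4), of "{..<n}"] card three_le by auto
      then obtain j where "j < n" "j \<notin> S'" by auto
      then show thesis
        using card sub k by (intro that[of "insert j S'"]) (auto simp: feasible_leaders_def)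
    qed (use S' that in blast)
    have "ereal (total_variance n \<nu> S) \<le> ereal (total_variance n \<nu> T)"
      using ge(1) le[OF T(1,2)] by (rule order_trans)
    also have "\<dots> \<le> ereal (total_variance n \<nu> S')"
      using total_variance_antimono[OF T(3) _ sub(2)] T(1) by (simp add: feasible_leaders_def)
    finally show ?thesis by simp
  qed
qed

end

section \<open>The number of operations\<close>

text \<open>
  The bounds below have one form: a loop of \<open>m\<close> rounds costs \<open>m\<close> times the price of a round on its most
  expensive branch, plus one for advancing the counter. Only two lengths are not explicit: that of an
  arc, which is less than \<open>n\<close>, and that of the path, which is at most \<open>k + 1\<close>.
\<close>

lemma ops_loop_le:
  assumes "\<And>j s. j < m \<Longrightarrow> ops (f j s) \<le> c"
  shows "ops (loop m f s) \<le> m * (c + 1)"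
  using assms
proof (induction m)
  case (Suc m)
  have "ops (loop m f s) \<le> m * (c + 1)"
    using Suc by simp
  moreover have "ops (f m (result (loop m f s))) \<le> c"
    using Suc.prems by simp
  ultimately show ?case by simp
qed simp

lemma ops_array_of_le:
  assumes "\<And>j. j < m \<Longrightarrow> ops (f j) \<le> c"
  shows "ops (array_of m f) \<le> m * (c + 2)"
proof -
  have "ops (array_of m f) \<le> m * (c + 1 + 1)"
    unfolding array_of_def by (rule ops_loop_le) (use assms in force)
  then show ?thesis by simp
qed

lemma ops_laplacian_array: "ops (laplacian_array n \<nu>) \<le> n * (12 + n * 5 + 2)"
proof -
  have row: "ops (array_of n (\<lambda>j. branch (op (j = i)) (ret d) (branch (op (j = nx)) (ret a)
         (branch (op (j = pv)) (ret b) (ret 0))))) \<le> n * (3 + 2)" for i nx pv and a b d :: real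
    by (rule ops_array_of_le) simp
  show ?thesis
    unfolding laplacian_array_def by (rule ops_array_of_le) (use row in simp)
qed

lemma ops_pivots: "ops (pivots m a b) \<le> m * 10"
proof -
  have "ops (pivots m a b) \<le> m * (9 + 1)"
    unfolding pivots_def by (rule ops_loop_le) simp
  then show ?thesis by simp
qed

lemma ops_reverse_array: "ops (reverse_array m a) \<le> m * 5"
proof -
  have "ops (reverse_array m a) \<le> m * (3 + 2)"
    unfolding reverse_array_def by (rule ops_array_of_le) simp
  then show ?thesis by simp
qed

lemma ops_tridiagonal_trace_inverse: "ops (tridiagonal_trace_inverse m a b) \<le> 1 + m * 43"
proof -
  have L: "ops (loop m (\<lambda>j acc. do { d \<leftarrow> op (ds ! j); e \<leftarrow> op (es ! j); x \<leftarrow> op (a ! j);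
      s \<leftarrow> op (d + e); t \<leftarrow> op (s - x); r \<leftarrow> op (1 / t); op (acc + r) }) 0) \<le> m * (7 + 1)"
    for ds es
    by (rule ops_loop_le) simp
  have "ops (reverse_array (m - 1) b) \<le> m * 5"
    by (rule order_trans[OF ops_reverse_array]) simp
  then show ?thesis
    unfolding tridiagonal_trace_inverse_def
    using ops_pivots[of m a b] ops_reverse_array[of m a]
      ops_pivots[of m "result (reverse_array m a)" "result (reverse_array (m - 1) b)"]
      ops_reverse_array[of m "result (pivots m (result (reverse_array m a)) (result (reverse_array (m - 1) b)))"]
      L[of "result (pivots m a b)"
         "result (reverse_array m (result (pivots m (result (reverse_array m a)) (result (reverse_array (m - 1) b)))))"]
    by simp
qed

lemma ops_arc_weight:
  assumes "0 < n"
  shows "ops (arc_weight n L u v) \<le> 8 + n * 57"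
proof -
  define m where "m = (v + n - u) mod n - 1"
  have m: "m \<le> n"
    using mod_less_divisor[OF assms, of "v + n - u"] by (simp add: m_def)
  have a: "ops (array_of m (\<lambda>j. do { p \<leftarrow> op (u + 1 + j); p' \<leftarrow> op (p mod n); read2 L p' p' })) \<le> m * (4 + 2)"
    by (rule ops_array_of_le) simp
  have b: "ops (array_of (m - 1) (\<lambda>j. do { p \<leftarrow> op (u + 1 + j); q \<leftarrow> op (p + 1);
        p' \<leftarrow> op (p mod n); q' \<leftarrow> op (q mod n); read2 L p' q' })) \<le> (m - 1) * (6 + 2)"
    by (rule ops_array_of_le) simp
  have "ops (arc_weight n L u v) \<le> 6 + m * 6 + (m - 1) * 8 + (1 + m * 43) + 1"
    unfolding arc_weight_def
    using a b ops_tridiagonal_trace_inverse[of m 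
       "result (array_of m (\<lambda>j. do { p \<leftarrow> op (u + 1 + j); p' \<leftarrow> op (p mod n); read2 L p' p' }))"
       "result (array_of (m - 1) (\<lambda>j. do { p \<leftarrow> op (u + 1 + j); q \<leftarrow> op (p + 1);
        p' \<leftarrow> op (p mod n); q' \<leftarrow> op (q mod n); read2 L p' q' }))"]
    by (simp add: m_def)
  also have "\<dots> \<le> 8 + n * 57"
    using m by linarith
  finally show ?thesis .
qed

lemma ops_weight_table:
  assumes "0 < n"
  shows "ops (weight_table n L) \<le> n * (n * (8 + n * 57 + 1 + 2) + 2)"
  unfolding weight_table_def
proof (intro ops_array_of_le)
  fix u v assume "u < n" "v < n"
  show "ops (branch (op (u = v)) (ret 0) (arc_weight n L u v)) \<le> 8 + n * 57 + 1"
    using ops_arc_weight[OF assms, of L u v] by simp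
qed

lemma ops_leader_digraph: "ops (leader_digraph n W i) \<le> 1 + (n + 1) * ((n + 1) * 9 + 2)"
proof -
  have "ops (array_of (n + 1) (\<lambda>u. array_of (n + 1) (\<lambda>v.
       branch (op (u = n)) (ret None)
       (branch (op (v = i)) (ret None)
       (branch (op (u = v)) (ret None)
       (branch (op (v = n))
          (branch (op (u = i)) (ret None) (do { w \<leftarrow> read2 W u i; ret (Some w) }))
          (do { w \<leftarrow> read2 W u v; ret (Some w) }))))))) \<le> (n + 1) * ((n + 1) * (7 + 2) + 2)"
    by (intro ops_array_of_le) simp
  then show ?thesis
    by (simp add: leader_digraph_def)
qed

lemma ops_relax: "ops (relax N G D v) \<le> N * 7"
proof -
  have "ops (relax N G D v) \<le> N * (6 + 1)"
    unfolding relax_def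
    by (rule ops_loop_le) (auto split: option.splits prod.splits)
  then show ?thesis by simp
qed

lemma ops_bf_table: "ops (bf_table N G s H) \<le> N * 3 + H * (N * (N * 7 + 3) + 3)"
proof -
  let ?init = "array_of N (\<lambda>v. branch (op (v = s)) (ret (0::ereal, None::nat option)) (ret (\<infinity>, None)))"
  let ?step = "\<lambda>m Ds. do {
       D \<leftarrow> op (Ds ! m);
       D' \<leftarrow> array_of N (\<lambda>v. branch (op (v = s)) (ret (\<infinity>, None)) (relax N G D v));
       op (Ds @ [D'])
     }"
  have "ops ?init \<le> N * (1 + 2)"
    by (rule ops_array_of_le) simp
  moreover have "ops (loop H ?step [result ?init]) \<le> H * ((N * (N * 7 + 1 + 2) + 2) + 1)"
  proof (rule ops_loop_le)
    fix m and Ds :: "bf_row list"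
    have "ops (array_of N (\<lambda>v. branch (op (v = s)) (ret (\<infinity>, None)) (relax N G (Ds ! m) v))) \<le> N * (N * 7 + 1 + 2)"
    proof (rule ops_array_of_le)
      fix v
      show "ops (branch (op (v = s)) (ret (\<infinity>, None)) (relax N G (Ds ! m) v)) \<le> N * 7 + 1"
        using ops_relax[of N G "Ds ! m" v] by simp
    qed
    then show "ops (?step m Ds) \<le> N * (N * 7 + 1 + 2) + 2"
      by simp
  qed
  ultimately show ?thesis
    unfolding bf_table_def by (simp add: algebra_simps)
qed

lemma ops_bf_best: "ops (bf_best Ds t H) \<le> H * 5"
proof -
  have "ops (bf_best Ds t H) \<le> H * (4 + 1)"
    unfolding bf_best_def
    by (rule ops_loop_le) (simp split: prod.splits)
  then show ?thesis by simp
qed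

lemma ops_bf_path: "ops (bf_path Ds t m) \<le> m * 5"
proof -
  have "ops (loop m (\<lambda>j (v, path). do {
       l \<leftarrow> op (m - j);
       (_, p) \<leftarrow> read2 Ds l v;
       path' \<leftarrow> op (the p # path);
       ret (the p, path')
     }) (t, [t])) \<le> m * (4 + 1)"
    by (rule ops_loop_le) (simp split: prod.splits)
  then show ?thesis
    unfolding bf_path_def by (simp split: prod.splits)
qed

lemma bf_best_edges_le: "snd (result (bf_best Ds t H)) \<le> H"
proof -
  obtain w m where wm: "result (bf_best Ds t H) = (w, m)"
    by fastforce
  show ?thesis
    using bf_best_invariant(2)[OF wm] by (auto simp: wm)
qed

lemma length_fst_bellman_ford: "length (fst (result (bellman_ford N G s t H))) \<le> H + 1"
  using bf_best_edges_le[of "result (bf_table N G s H)" t H]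
  by (auto simp: bellman_ford_def length_bf_path split: prod.splits)

lemma ops_bellman_ford:
  "ops (bellman_ford N G s t H) \<le> N * 3 + H * (N * (N * 7 + 3) + 3) + H * 10 + 1"
proof -
  define Ds where "Ds = result (bf_table N G s H)"
  define m where "m = snd (result (bf_best Ds t H))"
  have "m \<le> H"
    using bf_best_edges_le by (simp add: m_def)
  then have "ops (bf_path Ds t m) \<le> H * 5"
    using ops_bf_path[of Ds t m] by linarith
  then show ?thesis
    using ops_bf_table[of N G s H] ops_bf_best[of Ds t H]
    by (simp add: bellman_ford_def m_def case_prod_unfold flip: Ds_def)
qed

lemma ops_remove_ends: "ops (remove_ends s t ps) \<le> 4 * length ps"
  by (induction ps) auto

lemma ops_candidate:
  "ops (candidate n W k i) \<le> 1 + (n + 1) * ((n + 1) * 9 + 2) + 1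
     + ((n + 1) * 3 + k * ((n + 1) * ((n + 1) * 7 + 3) + 3) + k * 10 + 1) + 4 * (k + 1) + 1"
proof -
  define G where "G = result (leader_digraph n W i)"
  define P where "P = fst (result (bellman_ford (n + 1) G i n k))"
  have rem: "ops (remove_ends i n P) \<le> 4 * (k + 1)"
    using ops_remove_ends[of i n P] length_fst_bellman_ford[of "n + 1" G i n k] by (simp add: P_def)
  have eq: "ops (candidate n W k i) = ops (leader_digraph n W i) + 1
      + ops (bellman_ford (n + 1) G i n k) + ops (remove_ends i n P) + 1"
    by (simp add: candidate_def P_def flip: G_def split: prod.splits)
  show ?thesis
    unfolding eq
    by (intro add_mono order_refl ops_leader_digraph ops_bellman_ford rem)
qed

text \<open>
  The constant is the sum of the coefficients when the bound is expanded into monomials in \<open>k\<close> and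
  \<open>n\<close>, each of which is at most \<open>k n\<^sup>3\<close>.
\<close>

lemma ops_leader_selection:
  assumes "1 \<le> n" "1 \<le> k"
  shows "ops (leader_selection n \<nu> k) \<le> 201 * (k * n ^ 3)"
proof -
  let ?c = "1 + (n + 1) * ((n + 1) * 9 + 2) + 1
     + ((n + 1) * 3 + k * ((n + 1) * ((n + 1) * 7 + 3) + 3) + k * 10 + 1) + 4 * (k + 1) + 1"
  have cs: "ops (array_of n (candidate n W k)) \<le> n * (?c + 2)" for W
    by (intro ops_array_of_le ops_candidate)
  have L: "ops (loop n (\<lambda>i b. do {
       (_, w) \<leftarrow> op (cs ! i);
       (_, w') \<leftarrow> op (cs ! b);
       branch (op (w < w')) (ret i) (ret b)
     }) 0) \<le> n * (3 + 1)" for cs :: "(nat list \<times> ereal) list"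
    by (rule ops_loop_le) (simp split: prod.splits)
  define La where "La = laplacian_array n \<nu>"
  define Wt where "Wt = weight_table n (result La)"
  define Cs where "Cs = array_of n (candidate n (result Wt) k)"
  have eq: "ops (leader_selection n \<nu> k) = ops La + ops Wt + ops Cs + ops (loop n (\<lambda>i b. do {
       (_, w) \<leftarrow> op (result Cs ! i);
       (_, w') \<leftarrow> op (result Cs ! b);
       branch (op (w < w')) (ret i) (ret b)
     }) 0) + 1"
    by (simp only: leader_selection_def ops_bind ops_op add.assoc La_def Wt_def Cs_def)
  have "ops (leader_selection n \<nu> k)
      \<le> n * (12 + n * 5 + 2) + n * (n * (8 + n * 57 + 1 + 2) + 2) + n * (?c + 2) + n * (3 + 1) + 1"
    unfolding eq
    by (intro add_mono order_refl L)
      (use assms cs in \<open>simp_all only: La_def Wt_def Cs_def ops_laplacian_array ops_weight_table\<close>)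
  also have "\<dots> \<le> 201 * (k * n ^ 3)"
  proof -
    have n: "1 \<le> n ^ 3" "n \<le> n ^ 3" "n ^ 2 \<le> n ^ 3"
      using assms by (auto intro: power_increasing self_le_power)
    have "1 * x \<le> k * x" for x
      using assms(2) by (rule mult_le_mono1)
    then have k: "x \<le> k * x" for x
      by simp
    have "1 \<le> k * n ^ 3" "n \<le> k * n ^ 3" "n ^ 2 \<le> k * n ^ 3" "n ^ 3 \<le> k * n ^ 3"
      using n k[of "n ^ 3"] by linarith+
    moreover have "k * n \<le> k * n ^ 3" "k * n ^ 2 \<le> k * n ^ 3"
      using n by (simp_all only: mult_le_mono2)
    moreover have "n * (12 + n * 5 + 2) + n * (n * (8 + n * 57 + 1 + 2) + 2) + n * (?c + 2) + n * (3 + 1) + 1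
        = 1 + 44 * n + 27 * (k * n) + 39 * n ^ 2 + 17 * (k * n ^ 2) + 66 * n ^ 3 + 7 * (k * n ^ 3)"
      by (simp add: algebra_simps power2_eq_square power3_eq_cube)
    ultimately show ?thesis
      by linarith
  qed
  finally show ?thesis .
qed

section \<open>The algorithm is correct and runs in time \<open>O(k n\<^sup>3)\<close>\<close>

theorem theorem2:
  shows "(\<forall>n k \<nu>. 3 \<le> n \<longrightarrow> 1 \<le> k \<longrightarrow> ring_noise n \<nu> \<longrightarrow>
            feasible_leaders n k (selected_leaders n \<nu> k) \<and>
            (2 \<le> k \<longrightarrow>
               is_arg_min (total_variance n \<nu>) (feasible_leaders n k) (selected_leaders n \<nu> k) \<and>
               selected_weight n \<nu> k = ereal (total_variance n \<nu> (selected_leaders n \<nu> k)))) \<and>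
         (\<exists>C. \<forall>n k \<nu>. 3 \<le> n \<longrightarrow> 1 \<le> k \<longrightarrow> ring_noise n \<nu> \<longrightarrow>
            ops (leader_selection n \<nu> k) \<le> C * (k * n ^ 3))"
proof (rule conjI)
  show "\<exists>C. \<forall>n k \<nu>. 3 \<le> n \<longrightarrow> 1 \<le> k \<longrightarrow> ring_noise n \<nu> \<longrightarrow>
            ops (leader_selection n \<nu> k) \<le> C * (k * n ^ 3)"
    using ops_leader_selection by (intro exI[of _ 201]) auto
next
  show "\<forall>n k \<nu>. 3 \<le> n \<longrightarrow> 1 \<le> k \<longrightarrow> ring_noise n \<nu> \<longrightarrow>
            feasible_leaders n k (selected_leaders n \<nu> k) \<and>
            (2 \<le> k \<longrightarrow>
               is_arg_min (total_variance n \<nu>) (feasible_leaders n k) (selected_leaders n \<nu> k) \<and>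
               selected_weight n \<nu> k = ereal (total_variance n \<nu> (selected_leaders n \<nu> k)))"
  proof (intro allI impI)
    fix n k :: nat and \<nu> :: "nat \<Rightarrow> nat \<Rightarrow> real"
    assume "3 \<le> n" "1 \<le> k" "ring_noise n \<nu>"
    then interpret ring_network n \<nu>
      by unfold_locales
    have "is_arg_min (total_variance n \<nu>) (feasible_leaders n k) (selected_leaders n \<nu> k)" if "2 \<le> k"
      using selected_optimal(2)[OF that] selected_feasible[OF \<open>1 \<le> k\<close>]
      by (auto simp: is_arg_min_def not_less)
    then show "feasible_leaders n k (selected_leaders n \<nu> k) \<and>
            (2 \<le> k \<longrightarrow>
               is_arg_min (total_variance n \<nu>) (feasible_leaders n k) (selected_leaders n \<nu> k) \<and>
               selected_weight n \<nu> k = ereal (total_variance n \<nu> (selected_leaders n \<nu> k)))"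
      using selected_feasible[OF \<open>1 \<le> k\<close>] selected_optimal(1) by blast
  qed
qed

end
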